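(* (i) There is a polynomial-time algorithm that, given a finite poset $P$, determines whether $P$ has an interval representation in which each interval length is either 0 or 1 and, in the affirmative case, produces such a representation. (ii) There is a polynomial-time algorithm that, given a finite poset $P=(X,\prec)$ and a weight function $f:X\to\{1,2\}$, determines whether $P$ has an interval representation $\{I_x:x\in X\}$ in which $|I_x|=f(x)$ for all $x\in X$ and, in the affirmative case, produces such a representation.
   Context: A poset $P=(X,\prec)$ is a finite set $X$ with an irreflexive, transitive relation $\prec$. An interval representation of $P$ assigns to each $v\in X$ a closed real interval $I_v$ (possibly a single point) so that $x\prec y$ if and only if $I_x$ is completely to the left of $I_y$. $|I_v|$ denotes the length of $I_v$. *)

theory Defs
  imports "HOL-Analysis.Analysis" "HOL-Computational_Algebra.Polynomial"
begin

section \<open>Interval representations of finite posets\<close>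

definition finite_poset :: "'a set \<Rightarrow> 'a rel \<Rightarrow> bool" where
  "finite_poset X R \<longleftrightarrow> finite X \<and> R \<subseteq> X \<times> X \<and> irrefl R \<and> trans R"

definition closed_interval :: "real set \<Rightarrow> bool" where
  "closed_interval S \<longleftrightarrow> (\<exists>a b. a \<le> b \<and> S = {a..b})"

definition completely_left_of :: "real set \<Rightarrow> real set \<Rightarrow> bool" where
  "completely_left_of S T \<longleftrightarrow> (\<forall>s\<in>S. \<forall>t\<in>T. s < t)"

definition interval_length :: "real set \<Rightarrow> real" where
  "interval_length S = measure lborel S"

definition interval_rep :: "'a set \<Rightarrow> 'a rel \<Rightarrow> ('a \<Rightarrow> real set) \<Rightarrow> bool" where
  "interval_rep X R I \<longleftrightarrow>
     (\<forall>v\<in>X. closed_interval (I v)) \<and>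
     (\<forall>x\<in>X. \<forall>y\<in>X. (x, y) \<in> R \<longleftrightarrow> completely_left_of (I x) (I y))"

definition interval_rep_01 :: "'a set \<Rightarrow> 'a rel \<Rightarrow> ('a \<Rightarrow> real set) \<Rightarrow> bool" where
  "interval_rep_01 X R I \<longleftrightarrow>
     interval_rep X R I \<and> (\<forall>v\<in>X. interval_length (I v) \<in> {0, 1})"

definition interval_rep_weighted ::
    "'a set \<Rightarrow> 'a rel \<Rightarrow> ('a \<Rightarrow> nat) \<Rightarrow> ('a \<Rightarrow> real set) \<Rightarrow> bool" where
  "interval_rep_weighted X R f I \<longleftrightarrow>
     interval_rep X R I \<and> (\<forall>v\<in>X. interval_length (I v) = real (f v))"

section \<open>Algorithms and their running time\<close>

text \<open>
  The model of computation is Jones' language WHILE: a program is a fixed piece of imperative code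
  with finitely many variables, each holding a binary tree. Every use of a variable is charged
  the size of its whole content, as if it were copied. Hence no value can be larger than the time
  spent (lemma \<open>size_le_cost\<close>), sharing of subtrees gives no advantage, and
  polynomial time in this model is polynomial time on Turing machines.
\<close>

datatype tree = Leaf | Node tree tree

datatype exp = Var nat | LeafE | NodeE exp exp | LeftE exp | RightE exp

datatype com =
    Skip
  | Assign nat exp
  | Seq com com
  | If exp com com
  | While exp com

type_synonym state = "nat \<Rightarrow> tree"

fun left :: "tree \<Rightarrow> tree" where
  "left Leaf = Leaf"
| "left (Node l r) = l"

fun right :: "tree \<Rightarrow> tree" where
  "right Leaf = Leaf"
| "right (Node l r) = r"

fun val :: "exp \<Rightarrow> state \<Rightarrow> tree" where
  "val (Var x) s = s x"
| "val LeafE s = Leaf"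
| "val (NodeE e1 e2) s = Node (val e1 s) (val e2 s)"
| "val (LeftE e) s = left (val e s)"
| "val (RightE e) s = right (val e s)"

fun cost :: "exp \<Rightarrow> state \<Rightarrow> nat" where
  "cost (Var x) s = 1 + size (s x)"
| "cost LeafE s = 1"
| "cost (NodeE e1 e2) s = 1 + cost e1 s + cost e2 s"
| "cost (LeftE e) s = 1 + cost e s"
| "cost (RightE e) s = 1 + cost e s"

lemma size_le_cost: "size (val e s) \<le> cost e s"
proof (induction e)
  case (LeftE e) then show ?case by (cases "val e s") auto
next
  case (RightE e) then show ?case by (cases "val e s") auto
qed auto

text \<open>\<open>exec c s t s'\<close>: started in \<open>s\<close>, the program \<open>c\<close> halts in \<open>s'\<close> after time \<open>t\<close>.
  Trees other than \<open>Leaf\<close> count as true.\<close>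

inductive exec :: "com \<Rightarrow> state \<Rightarrow> nat \<Rightarrow> state \<Rightarrow> bool" where
  Skip: "exec Skip s 1 s"
| Assign: "exec (Assign x e) s (1 + cost e s) (s(x := val e s))"
| Seq: "exec c1 s t1 s1 \<Longrightarrow> exec c2 s1 t2 s2 \<Longrightarrow> exec (Seq c1 c2) s (1 + t1 + t2) s2"
| IfTrue: "val e s \<noteq> Leaf \<Longrightarrow> exec c1 s t s' \<Longrightarrow> exec (If e c1 c2) s (1 + cost e s + t) s'"
| IfFalse: "val e s = Leaf \<Longrightarrow> exec c2 s t s' \<Longrightarrow> exec (If e c1 c2) s (1 + cost e s + t) s'"
| WhileTrue: "val e s \<noteq> Leaf \<Longrightarrow> exec c s t1 s1 \<Longrightarrow> exec (While e c) s1 t2 s2 \<Longrightarrow>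
    exec (While e c) s (1 + cost e s + t1 + t2) s2"
| WhileFalse: "val e s = Leaf \<Longrightarrow> exec (While e c) s (1 + cost e s) s"

inductive_cases SkipE: "exec Skip s t s'"
inductive_cases AssignE: "exec (Assign x e) s t s'"
inductive_cases SeqE: "exec (Seq c1 c2) s t s'"
inductive_cases IfE: "exec (If e c1 c2) s t s'"

lemma exec_deterministic:
  "exec c s t s' \<Longrightarrow> exec c s u s'' \<Longrightarrow> t = u \<and> s' = s''"
proof (induction arbitrary: u s'' rule: exec.induct)
  case (Skip s)
  then show ?case by (elim SkipE) simp
next
  case (Assign x e s)
  then show ?case by (elim AssignE) simp
next
  case (Seq c1 s t1 s1 c2 t2 s2)
  from Seq.prems obtain u1 r u2
    where r: "exec c1 s u1 r" "exec c2 r u2 s''" "u = 1 + u1 + u2"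
    by (elim SeqE) simp
  from Seq.IH(1)[OF r(1)] have "t1 = u1" "s1 = r" by simp_all
  with r Seq.IH(2)[of u2 s''] show ?case by simp
next
  case (IfTrue e s c1 t s' c2)
  from IfTrue.prems IfTrue.hyps obtain v where "exec c1 s v s''" "u = 1 + cost e s + v"
    by (elim IfE) simp_all
  with IfTrue.IH[of v s''] show ?case by simp
next
  case (IfFalse e s c2 t s' c1)
  from IfFalse.prems IfFalse.hyps obtain v where "exec c2 s v s''" "u = 1 + cost e s + v"
    by (elim IfE) simp_all
  with IfFalse.IH[of v s''] show ?case by simp
next
  case (WhileTrue e s c t1 s1 t2 s2)
  from WhileTrue.prems WhileTrue.hyps(1) obtain u1 r u2
    where r: "exec c s u1 r" "exec (While e c) r u2 s''" "u = 1 + cost e s + u1 + u2"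
    by (cases rule: exec.cases) simp_all
  from WhileTrue.IH(1)[OF r(1)] have "t1 = u1" "s1 = r" by simp_all
  with r WhileTrue.IH(2)[of u2 s''] show ?case by simp
next
  case (WhileFalse e s c)
  from WhileFalse.prems WhileFalse.hyps show ?case by (cases rule: exec.cases) simp_all
qed

text \<open>Input and output are passed in variable \<open>0\<close>; all other variables are initially empty.\<close>

definition computes_in_time :: "com \<Rightarrow> tree \<Rightarrow> tree \<Rightarrow> nat \<Rightarrow> bool" where
  "computes_in_time c a b t \<longleftrightarrow> (\<exists>s. exec c ((\<lambda>_. Leaf)(0 := a)) t s \<and> s 0 = b)"

text \<open>A search problem consists of a set \<open>D\<close> of instances and a relation \<open>S\<close> between instances and
  admissible answers; \<open>ein\<close> and \<open>eout\<close> encode instances and answers as trees.\<close>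

definition poly_time_solvable ::
    "('i \<Rightarrow> tree) \<Rightarrow> ('o \<Rightarrow> tree) \<Rightarrow> 'i set \<Rightarrow> ('i \<Rightarrow> 'o \<Rightarrow> bool) \<Rightarrow> bool" where
  "poly_time_solvable ein eout D S \<longleftrightarrow>
     (\<exists>(c :: com) (p :: nat poly). \<forall>i\<in>D. \<exists>out t.
        computes_in_time c (ein i) (eout out) t \<and> t \<le> poly p (size (ein i)) \<and> S i out)"

section \<open>Encodings\<close>

fun enc_bool :: "bool \<Rightarrow> tree" where
  "enc_bool False = Leaf"
| "enc_bool True = Node Leaf Leaf"

fun enc_list :: "('a \<Rightarrow> tree) \<Rightarrow> 'a list \<Rightarrow> tree" where
  "enc_list enc [] = Leaf"
| "enc_list enc (x # xs) = Node (enc x) (enc_list enc xs)"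

fun enc_prod :: "('a \<Rightarrow> tree) \<Rightarrow> ('b \<Rightarrow> tree) \<Rightarrow> 'a \<times> 'b \<Rightarrow> tree" where
  "enc_prod enc enc' (x, y) = Node (enc x) (enc' y)"

fun enc_option :: "('a \<Rightarrow> tree) \<Rightarrow> 'a option \<Rightarrow> tree" where
  "enc_option enc None = Leaf"
| "enc_option enc (Some x) = Node Leaf (enc x)"

text \<open>Binary digits, least significant first.\<close>

fun bits :: "nat \<Rightarrow> bool list" where
  "bits n = (if n = 0 then [] else odd n # bits (n div 2))"

declare bits.simps [simp del]

definition enc_nat :: "nat \<Rightarrow> tree" where
  "enc_nat n = enc_list enc_bool (bits n)"

definition enc_int :: "int \<Rightarrow> tree" where
  "enc_int k = enc_prod enc_bool enc_nat (k < 0, nat \<bar>k\<bar>)"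

text \<open>A poset is given to the algorithm by its adjacency matrix with respect to an enumeration \<open>xs\<close>
  of its elements.\<close>

definition adjacency_matrix :: "'a list \<Rightarrow> 'a rel \<Rightarrow> bool list list" where
  "adjacency_matrix xs R = map (\<lambda>x. map (\<lambda>y. (x, y) \<in> R) xs) xs"

definition enc_poset :: "'a list \<times> 'a rel \<Rightarrow> tree" where
  "enc_poset = (\<lambda>(xs, R). enc_list (enc_list enc_bool) (adjacency_matrix xs R))"

definition enc_weighted_poset :: "'a list \<times> 'a rel \<times> ('a \<Rightarrow> nat) \<Rightarrow> tree" where
  "enc_weighted_poset = (\<lambda>(xs, R, f). Node (enc_poset (xs, R)) (enc_list enc_nat (map f xs)))"

text \<open>An interval with rational endpoints is produced as a pair of (not necessarily reduced)
  fractions.\<close>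

type_synonym fraction = "int \<times> nat"

definition fraction_val :: "fraction \<Rightarrow> real" where
  "fraction_val = (\<lambda>(a, b). real_of_int a / real b)"

definition enc_fraction :: "fraction \<Rightarrow> tree" where
  "enc_fraction = enc_prod enc_int enc_nat"

type_synonym fraction_interval = "fraction \<times> fraction"

definition interval_of :: "fraction_interval \<Rightarrow> real set" where
  "interval_of = (\<lambda>(p, q). {fraction_val p..fraction_val q})"

definition proper_fractions :: "fraction_interval \<Rightarrow> bool" where
  "proper_fractions = (\<lambda>((a, b), (c, d)). b > 0 \<and> d > 0)"

definition enc_answer :: "fraction_interval list option \<Rightarrow> tree" where
  "enc_answer = enc_option (enc_list (enc_prod enc_fraction enc_fraction))"

text \<open>For a property \<open>Q\<close> of interval assignments on the elements listed in \<open>xs\<close>: the answer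
  \<open>None\<close> is correct iff no assignment (by arbitrary real intervals) satisfies \<open>Q\<close>; the answer
  \<open>Some J\<close> is correct iff \<open>J\<close> lists, in the order of \<open>xs\<close>, the intervals of an assignment
  satisfying \<open>Q\<close>.\<close>

fun correct_answer ::
    "'a list \<Rightarrow> (('a \<Rightarrow> real set) \<Rightarrow> bool) \<Rightarrow> fraction_interval list option \<Rightarrow> bool" where
  "correct_answer xs Q None \<longleftrightarrow> (\<nexists>I. Q I)"
| "correct_answer xs Q (Some J) \<longleftrightarrow>
     (\<forall>j\<in>set J. proper_fractions j) \<and> (\<exists>I. map I xs = map interval_of J \<and> Q I)"

end

theory Submission
  imports Defs
begin

text \<open>
  If the length \<open>w x\<close> of every interval is prescribed, a representation is a choice of left endpoints
  \<open>l\<close> such that \<open>l x + w x < l y\<close> holds exactly for the pairs with \<open>x\<close> below \<open>y\<close>. For integer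
  lengths only integer parts and the order of fractional parts matter, so if a solution exists at
  all, there is one whose values are multiples of \<open>1 / n\<close>, where \<open>n\<close> is the number of elements
  (\<open>integer_solution\<close>). Shifting makes the numerators nonnegative, and closing superfluous gaps makes them, for lengths
  at most two, smaller than \<open>n * (2 * n + 1)\<close> (\<open>bounded_solution\<close>).

  This bound allows a very simple search. Start with all left endpoints at zero and, in rounds, move every
  element that is too far left by one unit \<open>1 / n\<close>. The positions never exceed those of any solution
  (\<open>lift_le_solution\<close>), and each round with a violated constraint increases their sum. So after
  \<open>n * n * (2 * n + 1)\<close> rounds either all constraints hold, or no solution exists
  (\<open>lifted_stable\<close>, \<open>schedule_correct\<close>). This settles the problem with weights one and two.

  For lengths zero and one, an element that is incomparable to both members of a comparable pair must
  have length one. All other elements can be collapsed to points simultaneously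
  (\<open>forced_length_suffices\<close>). So the lengths can be read off from the poset, and the same search applies.

  That the search takes polynomial time is shown by combinators instead of an explicit
  program. The predicate \<open>ptime e e' f\<close> says that some program computes \<open>f\<close> in polynomial time, with
  arguments encoded by \<open>e\<close> and results by \<open>e'\<close>. It is closed under composition, pairing, case distinction and
  folding over a list with accumulators of polynomial size (\<open>ptime_comp\<close>, \<open>ptime_Pair\<close>,
  \<open>ptime_if\<close>, \<open>ptime_foldl\<close>). Unary arithmetic, list operations and the conversion to binary
  are obtained from these, and the algorithm is an ordinary functional program over them.
\<close>

section \<open>Integer solutions of the length constraints\<close>

text \<open>
  With remainders in \<open>[0, n)\<close>, comparing \<open>n * i + r\<close> is comparing \<open>(i, r)\<close> lexicographically.
  It is used over the reals with \<open>n = 1\<close> (integer and fractional part) and over the integers.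
\<close>

lemma lex_less_iff:
  fixes n r s :: "'a :: linordered_idom"
  assumes "0 \<le> r" "r < n" "0 \<le> s" "s < n"
  shows "n * of_int i + r < n * of_int j + s \<longleftrightarrow> i < j \<or> i = j \<and> r < s"
proof -
  have n: "n > 0" using assms by linarith
  have less: "n * of_int i + r < n * of_int j + s"
    if "i < j" "r < n" "0 \<le> s" for i j :: int and r s
  proof -
    from that have "of_int (i + 1) \<le> (of_int j :: 'a)" unfolding of_int_le_iff by simp
    then have "n * of_int (i + 1) \<le> n * of_int j" using n by (intro mult_left_mono) auto
    then show ?thesis using that by (simp add: algebra_simps)
  qed
  show ?thesis
    using less[of i j r s] less[of j i s r] assms by (cases i j rule: linorder_cases) auto
qed

text \<open>
  The lengths are integers, so whether \<open>l x + w x < l y\<close> holds depends only on the integer parts of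
  \<open>l x\<close> and \<open>l y\<close> and on the order of their fractional parts. Replacing each fractional part by its
  rank among the at most \<open>card V\<close> fractional parts, in units of \<open>1 / card V\<close>, therefore changes none of
  these comparisons. This is what makes the strict inequalities of an interval representation
  tractable: in units of \<open>1 / card V\<close> they are inequalities between integers.
\<close>

lemma integer_solution:
  fixes l :: "'a \<Rightarrow> real" and w :: "'a \<Rightarrow> nat"
  assumes fin: "finite V"
  obtains K :: "'a \<Rightarrow> int"
  where "\<forall>x\<in>V. \<forall>y\<in>V. l x + real (w x) < l y \<longleftrightarrow> K x + int (card V * w x) < K y"
proof (rule that, intro ballI)
  define rank where "rank x = card {z \<in> V. frac (l z) < frac (l x)}" for x
  define K where "K x = int (card V) * \<lfloor>l x\<rfloor> + int (rank x)" for x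
  fix x y assume xy: "x \<in> V" "y \<in> V"
  have rank: "rank z < card V" if "z \<in> V" for z
    unfolding rank_def using that by (intro psubset_card_mono fin) auto
  have mono: "rank a < rank b" if "a \<in> V" "frac (l a) < frac (l b)" for a b
    unfolding rank_def
    by (intro psubset_card_mono) (use that fin in \<open>auto intro: less_trans\<close>)
  have "frac (l x) < frac (l y) \<longleftrightarrow> rank x < rank y"
  proof (cases "frac (l x)" "frac (l y)" rule: linorder_cases)
    case less
    with mono[OF xy(1) less] show ?thesis by simp
  next
    case equal
    then have "rank x = rank y" by (simp add: rank_def)
    with equal show ?thesis by simp
  next
    case greater
    with mono[OF xy(2) greater] show ?thesis by simp
  qed
  moreover have "l x + real (w x) < l y \<longleftrightarrow>
      1 * of_int (\<lfloor>l x\<rfloor> + int (w x)) + frac (l x) < 1 * of_int \<lfloor>l y\<rfloor> + frac (l y)"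
    by (simp add: frac_def algebra_simps)
  moreover have "\<dots> \<longleftrightarrow> \<lfloor>l x\<rfloor> + int (w x) < \<lfloor>l y\<rfloor> \<or> \<lfloor>l x\<rfloor> + int (w x) = \<lfloor>l y\<rfloor> \<and> frac (l x) < frac (l y)"
    by (rule lex_less_iff) (simp_all add: frac_lt_1)
  moreover have "K x + int (card V * w x) < K y \<longleftrightarrow>
      int (card V) * of_int (\<lfloor>l x\<rfloor> + int (w x)) + int (rank x) < int (card V) * of_int \<lfloor>l y\<rfloor> + int (rank y)"
    by (simp add: K_def algebra_simps)
  moreover have "\<dots> \<longleftrightarrow> \<lfloor>l x\<rfloor> + int (w x) < \<lfloor>l y\<rfloor> \<or> \<lfloor>l x\<rfloor> + int (w x) = \<lfloor>l y\<rfloor> \<and> int (rank x) < int (rank y)"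
    by (rule lex_less_iff) (simp_all add: rank xy)
  ultimately show "l x + real (w x) < l y \<longleftrightarrow> K x + int (card V * w x) < K y"
    by simp
qed

lemma nat_solution:
  fixes K :: "'a \<Rightarrow> int" and W :: "'a \<Rightarrow> nat"
  assumes "finite V"
  obtains K' :: "'a \<Rightarrow> nat"
  where "\<forall>x\<in>V. \<forall>y\<in>V. K x + int (W x) < K y \<longleftrightarrow> K' x + W x < K' y"
proof (rule that, intro ballI)
  fix x y assume xy: "x \<in> V" "y \<in> V"
  let ?m = "Min (K ` V)"
  have "?m \<le> K x" "?m \<le> K y" using assms xy by auto
  then show "K x + int (W x) < K y \<longleftrightarrow> nat (K x - ?m) + W x < nat (K y - ?m)" by linarith
qed

text \<open>
  A solution with least sum has no wide gap. Cut the numbers below \<open>card V * Suc C\<close> into \<open>card V\<close>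
  blocks of width \<open>Suc C\<close>. If some value lies beyond all blocks, then the remaining
  \<open>card V - 1\<close> values miss a block; moving everything above that block down by one leaves a
  gap of at least \<open>Suc C\<close>, which exceeds every \<open>W x\<close>, so no comparison changes although the sum drops.
\<close>

lemma bounded_solution:
  fixes K W :: "'a \<Rightarrow> nat"
  assumes fin: "finite V" and W: "\<And>x. x \<in> V \<Longrightarrow> W x \<le> C"
  obtains K' :: "'a \<Rightarrow> nat"
  where "\<forall>x\<in>V. \<forall>y\<in>V. K x + W x < K y \<longleftrightarrow> K' x + W x < K' y"
    and "\<forall>x\<in>V. K' x < card V * Suc C"
proof -
  define sol where
    "sol K' \<longleftrightarrow> (\<forall>x\<in>V. \<forall>y\<in>V. K x + W x < K y \<longleftrightarrow> K' x + W x < K' y)" for K' :: "'a \<Rightarrow> nat"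
  have "sol K" by (simp add: sol_def)
  then obtain S where S: "sol S" and least: "\<And>S'. sol S' \<Longrightarrow> sum S V \<le> sum S' V"
    using ex_has_least_nat[of sol K "\<lambda>S. sum S V"] by blast
  have "S z < card V * Suc C" if z: "z \<in> V" for z
  proof (rule ccontr)
    assume big: "\<not> S z < card V * Suc C"
    have zdiv: "card V \<le> S z div Suc C"
      using big by (subst less_eq_div_iff_mult_less_eq) (auto simp: not_less)
    \<comment> \<open>pigeonhole: \<open>z\<close> lies in none of the \<open>card V\<close> blocks, and only \<open>card V - 1\<close> elements remain\<close>
    have "\<not> {..<card V} \<subseteq> (\<lambda>x. S x div Suc C) ` V"
    proof
      assume "{..<card V} \<subseteq> (\<lambda>x. S x div Suc C) ` V"
      then have "{..<card V} \<subseteq> (\<lambda>x. S x div Suc C) ` (V - {z})" using zdiv by fastforce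
      then have "card {..<card V} \<le> card (V - {z})" using fin by (intro surj_card_le) auto
      also have "\<dots> < card V" using z fin by (intro psubset_card_mono) auto
      finally show False by simp
    qed
    then obtain k where k: "k < card V" "\<And>x. x \<in> V \<Longrightarrow> S x div Suc C \<noteq> k" by blast
    define S' where "S' x = (if k < S x div Suc C then S x - 1 else S x)" for x
    have high: "k * Suc C + Suc C \<le> S x" if "k < S x div Suc C" for x
    proof -
      have "Suc k * Suc C \<le> S x div Suc C * Suc C" using that by (intro mult_right_mono) auto
      also have "\<dots> \<le> S x" by (rule div_times_less_eq_dividend)
      finally show ?thesis by simp
    qed
    have low: "S x < k * Suc C" if "x \<in> V" "\<not> k < S x div Suc C" for x
    proof -
      from that k(2)[of x] have "S x div Suc C < k" by simp
      then show ?thesis by (simp add: div_less_iff_less_mult)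
    qed
    have "sol S'"
      unfolding sol_def
    proof (intro ballI)
      fix x y assume xy: "x \<in> V" "y \<in> V"
      have "S x + W x < S y \<longleftrightarrow> S' x + W x < S' y"
      proof (cases "k < S x div Suc C"; cases "k < S y div Suc C")
        assume h: "k < S x div Suc C" "k < S y div Suc C"
        then show ?thesis using high[OF h(1)] high[OF h(2)] unfolding S'_def by simp linarith
      next
        assume h: "k < S x div Suc C" "\<not> k < S y div Suc C"
        then show ?thesis using high[OF h(1)] low[OF xy(2) h(2)] unfolding S'_def by simp
      next
        assume h: "\<not> k < S x div Suc C" "k < S y div Suc C"
        then show ?thesis using low[OF xy(1) h(1)] high[OF h(2)] W[OF xy(1)] unfolding S'_def by simp
      next
        assume "\<not> k < S x div Suc C" "\<not> k < S y div Suc C"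
        then show ?thesis unfolding S'_def by simp
      qed
      with S xy show "K x + W x < K y \<longleftrightarrow> S' x + W x < S' y" by (simp add: sol_def)
    qed
    have "sum S' V < sum S V"
    proof (rule sum_strict_mono_ex1[OF fin])
      show "\<forall>x\<in>V. S' x \<le> S x" by (simp add: S'_def)
      have "k < S z div Suc C" using zdiv k(1) by simp
      then have "S' z < S z" using high[of z] by (simp add: S'_def)
      then show "\<exists>x\<in>V. S' x < S x" using z by blast
    qed
    with least[OF \<open>sol S'\<close>] show False by simp
  qed
  with S that[of S] show thesis by (simp add: sol_def)
qed

section \<open>The algorithm\<close>

text \<open>
  Access is total, because the algorithm has to be defined on matrices and weight lists of any shape.
\<close>

definition nthd :: "'a \<Rightarrow> 'a list \<Rightarrow> nat \<Rightarrow> 'a" where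
  "nthd d xs i = (if i < length xs then xs ! i else d)"

definition entry :: "bool list list \<Rightarrow> nat \<Rightarrow> nat \<Rightarrow> bool" where
  "entry M x y = nthd False (nthd [] M x) y"

text \<open>
  In both cases \<open>y\<close> is too far left, so raising \<open>y\<close> is the repair that no solution can avoid. Together
  the two cases cover all ways in which a comparison can be wrong (\<open>stable_iff\<close>), and therefore positions
  never have to be lowered.
\<close>

definition conflict :: "bool list list \<Rightarrow> nat list \<Rightarrow> nat list \<Rightarrow> nat \<Rightarrow> bool" where
  "conflict M W L y = list_ex (\<lambda>x.
     (entry M x y \<and> nthd 0 L y \<le> nthd 0 L x + nthd 0 W x) \<or>
     (\<not> entry M y x \<and> nthd 0 L y + nthd 0 W y < nthd 0 L x)) [0..<length M]"

definition lift :: "bool list list \<Rightarrow> nat list \<Rightarrow> nat list \<Rightarrow> nat list" where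
  "lift M W L = map (\<lambda>y. if conflict M W L y then Suc (nthd 0 L y) else nthd 0 L y) [0..<length M]"

text \<open>
  The sum of all positions of a solution as in \<open>bounded_solution\<close>, with \<open>n > 0\<close> elements and lengths
  up to \<open>2 * n\<close> units, is below this number, and every round with a conflict raises the sum.
\<close>

definition rounds :: "nat \<Rightarrow> nat" where
  "rounds n = n * (n * Suc (n + n))"

definition lifted :: "bool list list \<Rightarrow> nat list \<Rightarrow> nat list" where
  "lifted M W = (lift M W ^^ rounds (length M)) (map (\<lambda>_. 0) [0..<length M])"

definition read_off :: "bool list list \<Rightarrow> nat list \<Rightarrow> nat list \<Rightarrow> fraction_interval list option" where
  "read_off M W L =
     (if list_ex (conflict M W L) [0..<length M] then None
      else Some (map (\<lambda>y. ((int (nthd 0 L y), length M), (int (nthd 0 L y + nthd 0 W y), length M)))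
        [0..<length M]))"

definition schedule :: "bool list list \<Rightarrow> nat list \<Rightarrow> fraction_interval list option" where
  "schedule M W = read_off M W (lifted M W)"

lemma nthd_map_upt [simp]: "nthd d (map f [0..<n]) i = (if i < n then f i else d)"
  by (simp add: nthd_def)

lemma length_lift [simp]: "length (lift M W L) = length M"
  by (simp add: lift_def)

abbreviation stable :: "bool list list \<Rightarrow> nat list \<Rightarrow> nat list \<Rightarrow> bool" where
  "stable M W L \<equiv> \<not> list_ex (conflict M W L) [0..<length M]"

lemma stable_iff:
  "stable M W L \<longleftrightarrow> (\<forall>x<length M. \<forall>y<length M.
     entry M x y \<longleftrightarrow> nthd 0 L x + nthd 0 W x < nthd 0 L y)"
  unfolding conflict_def list_ex_iff by (fastforce simp: not_le not_less)

text \<open>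
  Raising by one cannot overtake a solution: the partner \<open>x\<close> of a conflict at \<open>y\<close> is at most at its
  position in the solution, which already forces the solution to place \<open>y\<close> strictly higher.
  Hence the iteration from zero stays below every solution.
\<close>

lemma lift_le_solution:
  assumes S: "\<And>x y. x < length M \<Longrightarrow> y < length M \<Longrightarrow> entry M x y \<longleftrightarrow> S x + nthd 0 W x < S y"
    and L: "\<And>x. x < length M \<Longrightarrow> nthd 0 L x \<le> S x" and y: "y < length M"
  shows "nthd 0 (lift M W L) y \<le> S y"
proof (cases "conflict M W L y")
  case True
  then have "\<exists>x<length M. (entry M x y \<and> nthd 0 L y \<le> nthd 0 L x + nthd 0 W x) \<or>
     (\<not> entry M y x \<and> nthd 0 L y + nthd 0 W y < nthd 0 L x)"
    by (simp add: conflict_def list_ex_iff Bex_def)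
  then obtain x where x: "x < length M" and
    "(entry M x y \<and> nthd 0 L y \<le> nthd 0 L x + nthd 0 W x) \<or>
     (\<not> entry M y x \<and> nthd 0 L y + nthd 0 W y < nthd 0 L x)"
    by blast
  then have "nthd 0 L y < S y"
    unfolding S[OF x y] S[OF y x] using L[OF x] by linarith
  with True y show ?thesis by (simp add: lift_def)
next
  case False
  with L y show ?thesis by (simp add: lift_def)
qed

lemma lift_stable:
  assumes "stable M W L" "length L = length M"
  shows "lift M W L = L"
  using assms by (intro nth_equalityI) (auto simp: lift_def list_ex_iff nthd_def)

lemma sum_lift:
  assumes "\<not> stable M W L"
  shows "(\<Sum>y<length M. nthd 0 L y) < (\<Sum>y<length M. nthd 0 (lift M W L) y)"
  by (rule sum_strict_mono_ex1) (use assms in \<open>auto simp: lift_def list_ex_iff\<close>)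

lemma length_lift_funpow [simp]:
  "length ((lift M W ^^ i) (map (\<lambda>_. 0) [0..<length M])) = length M"
  by (cases i) auto

text \<open>
  Once stable, the positions no longer change; before that, each round contributes at least one.
\<close>

lemma stable_or_large:
  "stable M W ((lift M W ^^ i) (map (\<lambda>_. 0) [0..<length M])) \<or>
   i \<le> (\<Sum>y<length M. nthd 0 ((lift M W ^^ i) (map (\<lambda>_. 0) [0..<length M])) y)"
proof (induction i)
  case (Suc i)
  let ?L = "(lift M W ^^ i) (map (\<lambda>_. 0) [0..<length M])"
  show ?case
  proof (cases "stable M W ?L")
    case True
    then have "lift M W ?L = ?L" by (rule lift_stable) simp
    with True show ?thesis by simp
  next
    case False
    with Suc sum_lift[OF False] show ?thesis by auto
  qed
qed simp

lemma lifted_stable: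
  assumes S: "\<And>x y. x < length M \<Longrightarrow> y < length M \<Longrightarrow> entry M x y \<longleftrightarrow> S x + nthd 0 W x < S y"
    and W: "\<And>x. x < length M \<Longrightarrow> nthd 0 W x \<le> 2 * length M"
  shows "stable M W (lifted M W)"
proof (rule ccontr)
  assume unstable: "\<not> stable M W (lifted M W)"
  then have ne: "length M \<noteq> 0" by auto
  obtain S' where S': "\<forall>x\<in>{..<length M}. \<forall>y\<in>{..<length M}.
      S x + nthd 0 W x < S y \<longleftrightarrow> S' x + nthd 0 W x < S' y"
    and bound: "\<forall>x\<in>{..<length M}. S' x < card {..<length M} * Suc (2 * length M)"
    by (rule bounded_solution[where V = "{..<length M}" and W = "nthd 0 W" and K = S,
          OF finite_lessThan W[OF lessThan_iff[THEN iffD1]]])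
  have le: "y < length M \<Longrightarrow> nthd 0 ((lift M W ^^ i) (map (\<lambda>_. 0) [0..<length M])) y \<le> S' y" for i y
  proof (induction i arbitrary: y)
    case (Suc i)
    show ?case
      unfolding funpow.simps comp_def
      by (rule lift_le_solution) (use S S' Suc in auto)
  qed simp
  have "rounds (length M) \<le> (\<Sum>y<length M. nthd 0 (lifted M W) y)"
    using stable_or_large[of M W "rounds (length M)"] unstable by (simp add: lifted_def)
  also have "\<dots> \<le> (\<Sum>y<length M. S' y)"
    by (rule sum_mono) (use le in \<open>auto simp: lifted_def\<close>)
  also have "\<dots> < (\<Sum>y<length M. length M * Suc (2 * length M))"
    by (rule sum_strict_mono) (use bound ne in auto)
  also have "\<dots> = rounds (length M)" by (simp add: rounds_def mult_2)
  finally show False by simp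
qed

section \<open>Correctness for prescribed lengths\<close>

lemma completely_left_of_iff:
  "a \<le> b \<Longrightarrow> c \<le> d \<Longrightarrow> completely_left_of {a..b} {c..d} \<longleftrightarrow> b < c"
proof
  assume le: "a \<le> b" "c \<le> d" and "completely_left_of {a..b} {c..d}"
  then have "\<forall>s\<in>{a..b}. \<forall>t\<in>{c..d}. s < t" by (simp only: completely_left_of_def)
  moreover have "b \<in> {a..b}" "c \<in> {c..d}" using le by simp_all
  ultimately show "b < c" by blast
next
  assume "b < c"
  then show "completely_left_of {a..b} {c..d}" by (simp add: completely_left_of_def)
qed

lemma interval_rep_endpoints:
  assumes "\<And>x. x \<in> X \<Longrightarrow> l x \<le> r x" "\<And>x. x \<in> X \<Longrightarrow> I x = {l x..r x}"
  shows "interval_rep X R I \<longleftrightarrow> (\<forall>x\<in>X. \<forall>y\<in>X. (x, y) \<in> R \<longleftrightarrow> r x < l y)"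
proof -
  have "closed_interval (I x)" if "x \<in> X" for x
    unfolding closed_interval_def
    by (rule exI[of _ "l x"], rule exI[of _ "r x"]) (simp add: assms that)
  moreover have "completely_left_of (I x) (I y) \<longleftrightarrow> r x < l y" if "x \<in> X" "y \<in> X" for x y
    using that by (simp add: assms completely_left_of_iff)
  ultimately show ?thesis by (simp add: interval_rep_def)
qed

lemma interval_rep_obtain_endpoints:
  assumes "interval_rep X R I"
  obtains l r where "\<forall>x\<in>X. l x \<le> r x \<and> I x = {l x..r x}"
proof -
  have "\<forall>x\<in>X. \<exists>a b. a \<le> b \<and> I x = {a..b}"
    using assms by (simp add: interval_rep_def closed_interval_def)
  then obtain l where "\<forall>x\<in>X. \<exists>b. l x \<le> b \<and> I x = {l x..b}"
    by (rule exE[OF bchoice])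
  then obtain r where "\<forall>x\<in>X. l x \<le> r x \<and> I x = {l x..r x}"
    by (rule exE[OF bchoice])
  then show ?thesis by (rule that)
qed

lemma interval_length_endpoints: "a \<le> b \<Longrightarrow> interval_length {a..b} = b - a"
  by (simp add: interval_length_def)

lemma interval_rep_weighted_iff:
  assumes "\<And>x. x \<in> X \<Longrightarrow> I x = {l x..l x + real (w x)}"
  shows "interval_rep_weighted X R w I \<longleftrightarrow>
    (\<forall>x\<in>X. \<forall>y\<in>X. (x, y) \<in> R \<longleftrightarrow> l x + real (w x) < l y)"
proof -
  have "interval_rep X R I \<longleftrightarrow> (\<forall>x\<in>X. \<forall>y\<in>X. (x, y) \<in> R \<longleftrightarrow> l x + real (w x) < l y)"
    by (rule interval_rep_endpoints) (simp_all add: assms)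
  moreover have "\<forall>x\<in>X. interval_length (I x) = real (w x)"
    by (simp add: assms interval_length_endpoints)
  ultimately show ?thesis by (simp add: interval_rep_weighted_def)
qed

lemma interval_rep_weighted_obtain:
  assumes "interval_rep_weighted X R w I"
  obtains l where "\<forall>x\<in>X. \<forall>y\<in>X. (x, y) \<in> R \<longleftrightarrow> l x + real (w x) < l y"
proof -
  from assms have I: "interval_rep X R I" and w: "\<And>x. x \<in> X \<Longrightarrow> interval_length (I x) = real (w x)"
    unfolding interval_rep_weighted_def by blast+
  obtain l r where "\<forall>x\<in>X. l x \<le> r x \<and> I x = {l x..r x}"
    by (rule interval_rep_obtain_endpoints[OF I])
  then have lr: "l x \<le> r x" "I x = {l x..r x}" if "x \<in> X" for x
    using that by blast+
  have r: "r x = l x + real (w x)" if "x \<in> X" for x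
    using lr[OF that] w[OF that] by (simp add: interval_length_endpoints)
  show ?thesis
  proof (rule that[of l], intro ballI)
    fix x y assume xy: "x \<in> X" "y \<in> X"
    have "\<forall>x\<in>X. \<forall>y\<in>X. (x, y) \<in> R \<longleftrightarrow> r x < l y"
      by (rule iffD1[OF interval_rep_endpoints I]) (simp_all only: lr)
    with xy have "(x, y) \<in> R \<longleftrightarrow> r x < l y" by simp
    then show "(x, y) \<in> R \<longleftrightarrow> l x + real (w x) < l y" by (simp add: r xy)
  qed
qed

lemma entry_adjacency_matrix:
  "x < length xs \<Longrightarrow> y < length xs \<Longrightarrow> entry (adjacency_matrix xs R) x y \<longleftrightarrow> (xs ! x, xs ! y) \<in> R"
  by (simp add: entry_def nthd_def adjacency_matrix_def)

lemma length_adjacency_matrix [simp]: "length (adjacency_matrix xs R) = length xs"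
  by (simp add: adjacency_matrix_def)

text \<open>
  All positions count units of \<open>1 / length xs\<close>. A stable list of positions yields the intervals
  directly. Conversely a representation yields left endpoints, then an integer solution, and so
  the iteration must have stabilized.
\<close>

theorem schedule_correct:
  assumes dist: "distinct xs" and w: "\<And>x. x \<in> set xs \<Longrightarrow> w x \<le> 2"
    and W: "\<And>i. i < length xs \<Longrightarrow> nthd 0 W i = length xs * w (xs ! i)"
  shows "correct_answer xs (interval_rep_weighted (set xs) R w) (schedule (adjacency_matrix xs R) W)"
proof -
  let ?M = "adjacency_matrix xs R" and ?n = "length xs"
  let ?L = "lifted ?M W"
  show ?thesis
  proof (cases "stable ?M W ?L")
    case True
    define J where "J = map (\<lambda>y. ((int (nthd 0 ?L y), ?n), (int (nthd 0 ?L y + nthd 0 W y), ?n))) [0..<?n]"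
    have answer: "schedule ?M W = Some J"
      using True by (simp add: schedule_def read_off_def J_def)
    define idx where "idx = inv_into {..<?n} ((!) xs)"
    have idx: "idx (xs ! i) = i" if "i < ?n" for i
      unfolding idx_def using that dist by (intro inv_into_f_f) (auto simp: inj_on_nth)
    define l where "l x = real (nthd 0 ?L (idx x)) / real ?n" for x
    define I where "I x = {l x..l x + real (w x)}" for x
    have "interval_rep_weighted (set xs) R w I"
    proof (subst interval_rep_weighted_iff[where l = l])
      show "\<forall>x\<in>set xs. \<forall>y\<in>set xs. (x, y) \<in> R \<longleftrightarrow> l x + real (w x) < l y"
      proof (intro ballI)
        fix x y assume "x \<in> set xs" "y \<in> set xs"
        then obtain i j where ij: "i < ?n" "j < ?n" "x = xs ! i" "y = xs ! j"
          by (metis in_set_conv_nth)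
        have n: "real ?n > 0" using ij by (cases xs) auto
        have "(x, y) \<in> R \<longleftrightarrow> nthd 0 ?L i + ?n * w x < nthd 0 ?L j"
          using True[unfolded stable_iff] ij by (simp add: entry_adjacency_matrix W)
        also have "\<dots> \<longleftrightarrow> real (nthd 0 ?L i + ?n * w x) / real ?n < real (nthd 0 ?L j) / real ?n"
          using n by (simp only: divide_less_cancel of_nat_less_iff) auto
        also have "real (nthd 0 ?L i + ?n * w x) / real ?n = l x + real (w x)"
          using n by (simp add: l_def ij idx add_divide_distrib)
        also have "real (nthd 0 ?L j) / real ?n = l y"
          by (simp add: l_def ij idx)
        finally show "(x, y) \<in> R \<longleftrightarrow> l x + real (w x) < l y" .
      qed
    qed (simp add: I_def)
    moreover have "map I xs = map interval_of J"
    proof (rule nth_equalityI)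
      fix i assume i: "i < length (map I xs)"
      then have n: "real ?n > 0" by (cases xs) auto
      from i n show "map I xs ! i = map interval_of J ! i"
        by (simp add: J_def I_def interval_of_def fraction_val_def l_def idx W field_simps)
    qed (simp add: J_def)
    moreover have "\<forall>j\<in>set J. proper_fractions j"
      by (auto simp: J_def proper_fractions_def)
    ultimately show ?thesis by (auto simp: answer)
  next
    case False
    have "\<not> interval_rep_weighted (set xs) R w I" for I
    proof
      assume "interval_rep_weighted (set xs) R w I"
      then obtain l where l: "\<forall>x\<in>set xs. \<forall>y\<in>set xs. (x, y) \<in> R \<longleftrightarrow> l x + real (w x) < l y"
        by (rule interval_rep_weighted_obtain)
      obtain K where K: "\<forall>x\<in>set xs. \<forall>y\<in>set xs.
          l x + real (w x) < l y \<longleftrightarrow> K x + int (card (set xs) * w x) < K y"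
        by (rule integer_solution[OF finite_set, of xs l w])
      obtain S where S: "\<forall>x\<in>set xs. \<forall>y\<in>set xs.
          K x + int (card (set xs) * w x) < K y \<longleftrightarrow> S x + card (set xs) * w x < S y"
        by (rule nat_solution[OF finite_set, of xs K "\<lambda>x. card (set xs) * w x"])
      have S': "(x, y) \<in> R \<longleftrightarrow> S x + length xs * w x < S y" if "x \<in> set xs" "y \<in> set xs" for x y
        using l K S that unfolding distinct_card[OF dist] by blast
      have "stable ?M W ?L"
      proof (rule lifted_stable[where S = "\<lambda>i. S (xs ! i)"])
        show "nthd 0 W x \<le> 2 * length ?M" if "x < length ?M" for x
          using that w[of "xs ! x"] by (simp add: W)
      qed (simp add: entry_adjacency_matrix S' W)
      with False show False by simp
    qed
    then show ?thesis using False by (simp add: schedule_def read_off_def)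
  qed
qed

section \<open>Choosing between lengths zero and one\<close>

text \<open>
  In a representation such an element meets two disjoint intervals, so it cannot be a single point
  and is forced to have length one.
\<close>

definition needs_length :: "'a set \<Rightarrow> 'a rel \<Rightarrow> 'a \<Rightarrow> bool" where
  "needs_length X R v \<longleftrightarrow> (\<exists>x\<in>X. \<exists>y\<in>X. (v, x) \<notin> R \<and> (x, v) \<notin> R \<and> (v, y) \<notin> R \<and> (y, v) \<notin> R \<and> (x, y) \<in> R)"

definition forced_length :: "'a set \<Rightarrow> 'a rel \<Rightarrow> 'a \<Rightarrow> nat" where
  "forced_length X R v = (if needs_length X R v then 1 else 0)"

text \<open>
  All other elements can be shrunk to points at once. If \<open>v\<close> is not forced, then the elements
  incomparable to \<open>v\<close>, together with \<open>v\<close>, are pairwise incomparable, so in the given representation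
  their intervals pairwise meet and share the largest of their left endpoints, \<open>p v\<close>
  (Helly's theorem on the line). Collapsing \<open>v\<close> to \<open>p v\<close> keeps all its intersections, and it creates
  none because \<open>p v\<close> lies in the old interval. Two incomparable elements that are both collapsed have the same
  neighbours and hence the same point.
\<close>

lemma forced_length_suffices:
  assumes X: "finite X" and I: "interval_rep_01 X R I"
  obtains J where "interval_rep_weighted X R (forced_length X R) J"
proof -
  from I have rep: "interval_rep X R I" and len: "\<And>x. x \<in> X \<Longrightarrow> interval_length (I x) \<in> {0, 1}"
    unfolding interval_rep_01_def by blast+
  obtain l r where "\<forall>x\<in>X. l x \<le> r x \<and> I x = {l x..r x}"
    by (rule interval_rep_obtain_endpoints[OF rep])
  then have lr: "l x \<le> r x" and Ilr: "I x = {l x..r x}" if "x \<in> X" for x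
    using that by blast+
  have "\<forall>x\<in>X. \<forall>y\<in>X. (x, y) \<in> R \<longleftrightarrow> r x < l y"
    by (rule iffD1[OF interval_rep_endpoints rep]) (simp_all only: lr Ilr)
  then have R: "(x, y) \<in> R \<longleftrightarrow> r x < l y" if "x \<in> X" "y \<in> X" for x y
    using that by simp
  define inc where "inc x = {y \<in> X. (x, y) \<notin> R \<and> (y, x) \<notin> R}" for x
  have inc_self: "x \<in> inc x" if "x \<in> X" for x
    using that R lr by (fastforce simp: inc_def)
  have fin: "finite (inc x)" for x using X by (simp add: inc_def)
  define p where "p x = Max (l ` inc x)" for x
  have p_ge: "l y \<le> p x" if "y \<in> inc x" for x y
    unfolding p_def using that fin by simp
  have p_mem: "\<exists>y\<in>inc x. p x = l y" if "x \<in> X" for x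
  proof -
    have "Max (l ` inc x) \<in> l ` inc x"
      by (rule Max_in) (use fin inc_self[OF that] in blast)+
    then show ?thesis by (auto simp: p_def)
  qed
  let ?N = "needs_length X R"
  have len1: "r x = l x + 1" if x: "x \<in> X" and N: "?N x" for x
  proof -
    from N obtain y z where yz: "y \<in> X" "z \<in> X" "(x, y) \<notin> R" "(y, x) \<notin> R" "(x, z) \<notin> R" "(z, x) \<notin> R" "(y, z) \<in> R"
      unfolding needs_length_def by blast
    then have "r x \<noteq> l x" using R x by force
    then show ?thesis using len[OF x] lr[OF x] Ilr[OF x] by (simp add: interval_length_endpoints)
  qed
  \<comment> \<open>the incomparables of an element that is not forced are pairwise incomparable\<close>
  have clique: "(y, z) \<notin> R" if "\<not> ?N x" "y \<in> inc x" "z \<in> inc x" for x y z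
    using that unfolding needs_length_def inc_def by blast
  \<comment> \<open>the endpoints after collapsing every element that is not forced to have length one\<close>
  define l' r' where "l' x = (if ?N x then l x else p x)" and "r' x = (if ?N x then r x else p x)" for x
  have l': "l x \<le> l' x" and r': "r' x \<le> r x" and l'r': "l' x \<le> r' x" if x: "x \<in> X" for x
  proof -
    show "l x \<le> l' x" using p_ge[OF inc_self[OF x]] by (simp add: l'_def)
    obtain y where "y \<in> inc x" "p x = l y" using p_mem[OF x] by blast
    then have "p x \<le> r x" using R[of x y] x by (simp add: inc_def)
    then show "r' x \<le> r x" "l' x \<le> r' x" using lr[OF x] by (simp_all add: l'_def r'_def)
  qed
  have new: "(x, y) \<in> R \<longleftrightarrow> r' x < l' y" if xy: "x \<in> X" "y \<in> X" for x y
  proof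
    assume "(x, y) \<in> R"
    then show "r' x < l' y" using R[OF xy] r'[OF xy(1)] l'[OF xy(2)] by simp
  next
    assume less: "r' x < l' y"
    show "(x, y) \<in> R"
    proof (rule ccontr)
      assume nxy: "(x, y) \<notin> R"
      have "(y, x) \<notin> R"
        using less R[OF xy(2,1)] l'[OF xy(1)] l'r'[OF xy(1)] l'r'[OF xy(2)] r'[OF xy(2)] by auto
      then have inc: "y \<in> inc x" "x \<in> inc y" using nxy xy by (auto simp: inc_def)
      have "l' y \<le> r' x"
      proof (cases "?N y")
        case True
        then show ?thesis using R[OF xy] nxy p_ge[OF inc(1)] by (simp add: l'_def r'_def)
      next
        case False
        obtain z where z: "z \<in> inc y" "p y = l z" using p_mem[OF xy(2)] by blast
        have "(x, z) \<notin> R" "(z, x) \<notin> R" using clique[OF False] inc z by auto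
        moreover have "z \<in> X" using z by (simp add: inc_def)
        ultimately have "l z \<le> r x" "l z \<le> p x" using R[OF xy(1)] p_ge[of z x] by (auto simp: inc_def)
        then show ?thesis using False z by (simp add: l'_def r'_def)
      qed
      with less show False by simp
    qed
  qed
  have r'l': "r' x = l' x + real (forced_length X R x)" if "x \<in> X" for x
    using len1[OF that] by (simp add: l'_def r'_def forced_length_def)
  have "interval_rep_weighted X R (forced_length X R) (\<lambda>x. {l' x..l' x + real (forced_length X R x)})"
    by (subst interval_rep_weighted_iff[where l = l']) (use new r'l' in auto)
  with that show thesis .
qed

lemma interval_rep_weighted_01:
  assumes "interval_rep_weighted X R w I" "\<And>x. x \<in> X \<Longrightarrow> w x \<in> {0, 1}"
  shows "interval_rep_01 X R I"
proof -
  have "interval_length (I v) \<in> {0, 1}" if "v \<in> X" for v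
    using assms(1) assms(2)[OF that] that by (auto simp: interval_rep_weighted_def)
  with assms(1) show ?thesis by (simp add: interval_rep_weighted_def interval_rep_01_def)
qed

lemma correct_answer_transfer:
  assumes "correct_answer xs Q a" "\<And>I. Q I \<Longrightarrow> Q' I" "\<And>I. Q' I \<Longrightarrow> \<exists>J. Q J"
  shows "correct_answer xs Q' a"
proof (cases a)
  case None
  with assms(1) have "\<nexists>I. Q I" by simp
  with assms(3) have "\<nexists>I. Q' I" by blast
  with None show ?thesis by simp
next
  case (Some J)
  with assms(1) obtain I where "\<forall>j\<in>set J. proper_fractions j" "map I xs = map interval_of J" "Q I"
    by (simp del: map_eq_conv) blast
  with assms(2)[of I] Some show ?thesis by (simp del: map_eq_conv) blast
qed

definition scaled_01 :: "bool list list \<Rightarrow> nat list" where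
  "scaled_01 M = map (\<lambda>v.
     if list_ex (\<lambda>x. list_ex (\<lambda>y. \<not> entry M v x \<and> \<not> entry M x v \<and> \<not> entry M v y \<and> \<not> entry M y v \<and> entry M x y)
        [0..<length M]) [0..<length M]
     then length M else 0) [0..<length M]"

definition scaled_12 :: "bool list list \<Rightarrow> nat list \<Rightarrow> nat list" where
  "scaled_12 M fs = map (\<lambda>f. if odd f then length M else length M + length M) fs"

lemma schedule_01_correct:
  assumes "distinct xs"
  shows "correct_answer xs (interval_rep_01 (set xs) R)
    (schedule (adjacency_matrix xs R) (scaled_01 (adjacency_matrix xs R)))"
proof (rule correct_answer_transfer)
  let ?X = "set xs" and ?M = "adjacency_matrix xs R"
  show "correct_answer xs (interval_rep_weighted ?X R (forced_length ?X R)) (schedule ?M (scaled_01 ?M))"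
  proof (rule schedule_correct[OF assms])
    show "forced_length ?X R x \<le> 2" for x by (simp add: forced_length_def)
    have set: "set xs = (!) xs ` {0..<length xs}"
      by (auto simp: set_conv_nth)
    fix i assume i: "i < length xs"
    have "list_ex (\<lambda>x. list_ex (\<lambda>y. \<not> entry ?M i x \<and> \<not> entry ?M x i \<and> \<not> entry ?M i y \<and> \<not> entry ?M y i
        \<and> entry ?M x y) [0..<length ?M]) [0..<length ?M] \<longleftrightarrow> needs_length ?X R (xs ! i)"
      unfolding needs_length_def set list_ex_iff
      by (simp add: i entry_adjacency_matrix)
    then show "nthd 0 (scaled_01 ?M) i = length xs * forced_length ?X R (xs ! i)"
      using i by (simp add: scaled_01_def forced_length_def)
  qed
  show "interval_rep_01 ?X R I" if "interval_rep_weighted ?X R (forced_length ?X R) I" for I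
    by (rule interval_rep_weighted_01[OF that]) (simp add: forced_length_def)
  show "\<exists>J. interval_rep_weighted ?X R (forced_length ?X R) J" if "interval_rep_01 ?X R I" for I
    using forced_length_suffices[OF _ that] by blast
qed

lemma schedule_12_correct:
  assumes "distinct xs" "\<And>x. x \<in> set xs \<Longrightarrow> f x \<in> {1, 2}"
  shows "correct_answer xs (interval_rep_weighted (set xs) R f)
    (schedule (adjacency_matrix xs R) (scaled_12 (adjacency_matrix xs R) (map f xs)))"
proof (rule schedule_correct[OF assms(1)])
  show "f x \<le> 2" if "x \<in> set xs" for x using assms(2)[OF that] by auto
  show "nthd 0 (scaled_12 (adjacency_matrix xs R) (map f xs)) i = length xs * f (xs ! i)"
    if "i < length xs" for i
    using assms(2)[of "xs ! i"] that by (auto simp: scaled_12_def nthd_def)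
qed

section \<open>Polynomially bounded quantities\<close>

lemma poly_nat_mono:
  fixes p :: "nat poly"
  assumes "m \<le> n"
  shows "poly p m \<le> poly p n"
  using assms by (induction p) (auto intro!: add_mono mult_mono)

text \<open>
  Polynomial growth is measured in the size of the encoding, so that bounds for different
  subprograms on the same input can be added, multiplied and composed.
\<close>

definition pbound :: "('a \<Rightarrow> tree) \<Rightarrow> ('a \<Rightarrow> nat) \<Rightarrow> bool" where
  "pbound e g \<longleftrightarrow> (\<exists>p. \<forall>a. g a \<le> poly p (size (e a)))"

lemma exec_Assign: "s' = s(x := val e s) \<Longrightarrow> t = 1 + cost e s \<Longrightarrow> exec (Assign x e) s t s'"
  using exec.Assign by simp

named_theorems pbounds

lemma pbound_const [pbounds]: "pbound e (\<lambda>_. c)"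
  unfolding pbound_def by (rule exI[of _ "[:c:]"]) simp

lemma pbound_size: "pbound e (\<lambda>a. size (e a))"
  unfolding pbound_def by (rule exI[of _ "[:0, 1:]"]) simp

lemma pbound_mono: "pbound e g \<Longrightarrow> (\<And>a. h a \<le> g a) \<Longrightarrow> pbound e h"
  unfolding pbound_def using le_trans by blast

lemma pbound_add [pbounds]:
  assumes "pbound e g" "pbound e h"
  shows "pbound e (\<lambda>a. g a + h a)"
proof -
  from assms obtain p q
    where "\<forall>a. g a \<le> poly p (size (e a))" "\<forall>a. h a \<le> poly q (size (e a))"
    unfolding pbound_def by blast
  then have "\<forall>a. g a + h a \<le> poly (p + q) (size (e a))"
    by (simp add: add_mono)
  then show ?thesis unfolding pbound_def by blast
qed

lemma pbound_mult [pbounds]: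
  assumes "pbound e g" "pbound e h"
  shows "pbound e (\<lambda>a. g a * h a)"
proof -
  from assms obtain p q
    where "\<forall>a. g a \<le> poly p (size (e a))" "\<forall>a. h a \<le> poly q (size (e a))"
    unfolding pbound_def by blast
  then have "\<forall>a. g a * h a \<le> poly (p * q) (size (e a))"
    by (simp add: mult_mono)
  then show ?thesis unfolding pbound_def by blast
qed

lemma pbound_Suc [pbounds]: "pbound e g \<Longrightarrow> pbound e (\<lambda>a. Suc (g a))"
  using pbound_add[OF pbound_const[of e 1]] by simp

lemma pbound_poly:
  assumes "pbound e g"
  shows "pbound e (\<lambda>a. poly p (g a))"
proof -
  from assms obtain q where q: "\<forall>a. g a \<le> poly q (size (e a))"
    unfolding pbound_def by blast
  have "\<forall>a. poly p (g a) \<le> poly (pcompose p q) (size (e a))"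
    using q by (simp add: poly_pcompose poly_nat_mono)
  then show ?thesis unfolding pbound_def by blast
qed

section \<open>Functions computable in polynomial time\<close>

text \<open>
  A program that uses variables below \<open>k\<close> as scratch space: it may assume that they are empty,
  must leave them empty, and may change nothing but variable \<open>0\<close>. With this convention programs can
  be put one after the other without renaming variables, and a caller may keep its own
  data in variables from \<open>k\<close> on. The specification speaks only of trees that encode a value,
  so behaviour on malformed trees never matters.
\<close>

definition runs :: "com \<Rightarrow> nat \<Rightarrow> ('a \<Rightarrow> tree) \<Rightarrow> ('b \<Rightarrow> tree) \<Rightarrow> ('a \<Rightarrow> 'b) \<Rightarrow> ('a \<Rightarrow> nat) \<Rightarrow> bool" where
  "runs c k e e' f T \<longleftrightarrow>
     (\<forall>a s. s 0 = e a \<and> (\<forall>x. 0 < x \<and> x < k \<longrightarrow> s x = Leaf) \<longrightarrow>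
        (\<exists>t \<le> T a. exec c s t (s(0 := e' (f a)))))"

definition ptime :: "('a \<Rightarrow> tree) \<Rightarrow> ('b \<Rightarrow> tree) \<Rightarrow> ('a \<Rightarrow> 'b) \<Rightarrow> bool" where
  "ptime e e' f \<longleftrightarrow> (\<exists>c k T. pbound e T \<and> runs c k e e' f T)"

lemma runsD:
  assumes "runs c k e e' f T" "s 0 = e a" "\<And>x. 0 < x \<Longrightarrow> x < k \<Longrightarrow> s x = Leaf"
  obtains t where "t \<le> T a" "exec c s t (s(0 := e' (f a)))"
  using assms unfolding runs_def by blast

text \<open>
  Time bounds space: an assignment pays for the tree that it creates.
\<close>

lemma size_exec: "exec c s t s' \<Longrightarrow> size (s' x) \<le> size (s x) + t"
proof (induction rule: exec.induct)
  case (Assign y e s)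
  then show ?case using size_le_cost[of e s] by auto
qed auto

text \<open>
  Outputs have polynomial size; this is why polynomial time is closed under composition.
\<close>

lemma pbound_ptime:
  assumes "ptime e e' f"
  shows "pbound e (\<lambda>a. size (e' (f a)))"
proof -
  from assms obtain c k T where T: "pbound e T" and r: "runs c k e e' f T"
    unfolding ptime_def by blast
  have "size (e' (f a)) \<le> size (e a) + T a" for a
  proof -
    obtain t where "t \<le> T a" and
      "exec c ((\<lambda>_. Leaf)(0 := e a)) t (((\<lambda>_. Leaf)(0 := e a))(0 := e' (f a)))"
      by (rule runsD[OF r, of "(\<lambda>_. Leaf)(0 := e a)" a]) auto
    then show ?thesis using size_exec[of c _ t _ 0] by fastforce
  qed
  then show ?thesis
    by (rule pbound_mono[OF pbound_add[OF pbound_size T]])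
qed

text \<open>
  Only the trees matter, so a program may be reread as computing on another type
  with the same encodings.
\<close>

lemma ptime_cong:
  assumes "ptime e e' f" "\<And>a. e' (f a) = d' (g a)" "\<And>a. e a = d a"
  shows "ptime d d' g"
proof -
  have "e = d" using assms(3) by blast
  with assms(1,2) show ?thesis unfolding ptime_def runs_def by simp
qed

fun only_input :: "exp \<Rightarrow> bool" where
  "only_input (Var x) \<longleftrightarrow> x = 0"
| "only_input LeafE \<longleftrightarrow> True"
| "only_input (NodeE a b) \<longleftrightarrow> only_input a \<and> only_input b"
| "only_input (LeftE a) \<longleftrightarrow> only_input a"
| "only_input (RightE a) \<longleftrightarrow> only_input a"

lemma cost_only_input: "only_input E \<Longrightarrow> cost E s \<le> (2 * size E + 1) * (size (s 0) + 1)"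
proof (induction E)
  case (NodeE E1 E2)
  then have "cost (NodeE E1 E2) s \<le> 1 + (2 * size E1 + 1) * (size (s 0) + 1)
    + (2 * size E2 + 1) * (size (s 0) + 1)" by fastforce
  then show ?case by (simp add: algebra_simps)
qed auto

text \<open>
  A single assignment; this supplies all primitive operations.
\<close>

lemma ptime_exp:
  assumes "only_input E" "\<And>a s. s 0 = e a \<Longrightarrow> val E s = e' (f a)"
  shows "ptime e e' f"
  unfolding ptime_def
proof (intro exI conjI)
  let ?T = "\<lambda>a. Suc ((2 * size E + 1) * (size (e a) + 1))"
  show "pbound e ?T"
    by (intro pbounds pbound_size)
  show "runs (Assign 0 E) 0 e e' f ?T"
    unfolding runs_def
  proof (intro allI impI)
    fix a and s :: state
    assume s: "s 0 = e a \<and> (\<forall>x. 0 < x \<and> x < 0 \<longrightarrow> s x = Leaf)"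
    show "\<exists>t \<le> ?T a. exec (Assign 0 E) s t (s(0 := e' (f a)))"
      using exec.Assign[of 0 E s] assms(2)[of s a] cost_only_input[OF assms(1), of s] s
      by (intro exI[of _ "1 + cost E s"]) simp
  qed
qed

lemma ptime_id: "ptime e e (\<lambda>x. x)"
  by (rule ptime_exp[of "Var 0"]) auto

lemma ptime_comp:
  assumes "ptime e e' f" "ptime e' e'' g"
  shows "ptime e e'' (\<lambda>x. g (f x))"
proof -
  from assms obtain c1 k1 T1 c2 k2 T2 where
    T: "pbound e T1" "pbound e' T2" and r: "runs c1 k1 e e' f T1" "runs c2 k2 e' e'' g T2"
    unfolding ptime_def by blast
  let ?T = "\<lambda>a. Suc (T1 a + T2 (f a))"
  obtain p where p: "\<And>a. T2 a \<le> poly p (size (e' a))"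
    using T(2) unfolding pbound_def by blast
  have "pbound e (\<lambda>a. T2 (f a))"
    by (rule pbound_mono[OF pbound_poly[OF pbound_ptime[OF assms(1)], of p]]) (rule p)
  then have "pbound e ?T" by (intro pbounds T)
  moreover have "runs (Seq c1 c2) (max k1 k2) e e'' (\<lambda>x. g (f x)) ?T"
    unfolding runs_def
  proof (intro allI impI)
    fix a and s :: state
    assume s: "s 0 = e a \<and> (\<forall>x. 0 < x \<and> x < max k1 k2 \<longrightarrow> s x = Leaf)"
    obtain t1 where t1: "t1 \<le> T1 a" "exec c1 s t1 (s(0 := e' (f a)))"
      by (rule runsD[OF r(1), of s a]) (use s in auto)
    obtain t2 where t2: "t2 \<le> T2 (f a)" "exec c2 (s(0 := e' (f a))) t2 (s(0 := e'' (g (f a))))"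
      by (rule runsD[OF r(2), of "s(0 := e' (f a))" "f a"]) (use s in auto)
    show "\<exists>t \<le> ?T a. exec (Seq c1 c2) s t (s(0 := e'' (g (f a))))"
      using exec.Seq[OF t1(2) t2(2)] t1(1) t2(1) by (intro exI[of _ "1 + t1 + t2"]) simp
  qed
  ultimately show ?thesis unfolding ptime_def by blast
qed

text \<open>
  The input is kept in variable \<open>m\<close>, beyond the scratch space of both programs, while the first one runs, and the
  first result in \<open>m + 1\<close> while the second one runs.
\<close>

lemma ptime_Pair:
  assumes "ptime e e1 f" "ptime e e2 g"
  shows "ptime e (enc_prod e1 e2) (\<lambda>x. (f x, g x))"
proof -
  from assms obtain c1 k1 T1 c2 k2 T2 where
    T: "pbound e T1" "pbound e T2" and r: "runs c1 k1 e e1 f T1" "runs c2 k2 e e2 g T2"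
    unfolding ptime_def by blast
  define m where "m = Suc (max k1 k2)"
  have m: "m \<noteq> 0" "k1 < m" "k2 < m" by (auto simp: m_def)
  let ?c = "Seq (Assign m (Var 0)) (Seq c1 (Seq (Assign (Suc m) (Var 0)) (Seq (Assign 0 (Var m))
    (Seq (Assign m LeafE) (Seq c2 (Seq (Assign 0 (NodeE (Var (Suc m)) (Var 0)))
    (Assign (Suc m) LeafE)))))))"
  let ?T = "\<lambda>a. T1 a + T2 a + (2 * size (e a) + 2 * size (e1 (f a)) + size (e2 (g a))) + 30"
  have "pbound e ?T" by (intro pbounds T pbound_size pbound_ptime assms)
  moreover have "runs ?c (m + 2) e (enc_prod e1 e2) (\<lambda>x. (f x, g x)) ?T"
    unfolding runs_def
  proof (intro allI impI)
    fix a and s :: state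
    assume s: "s 0 = e a \<and> (\<forall>x. 0 < x \<and> x < m + 2 \<longrightarrow> s x = Leaf)"
    let ?s1 = "s(m := e a)"
    let ?s2 = "?s1(0 := e1 (f a))"
    let ?s3 = "?s2(Suc m := e1 (f a))"
    let ?s4 = "?s3(0 := e a)"
    let ?s5 = "?s4(m := Leaf)"
    let ?s6 = "?s5(0 := e2 (g a))"
    let ?s7 = "?s6(0 := Node (e1 (f a)) (e2 (g a)))"
    let ?s8 = "?s7(Suc m := Leaf)"
    obtain t1 where t1: "t1 \<le> T1 a" "exec c1 ?s1 t1 ?s2"
      by (rule runsD[OF r(1), of ?s1 a]) (use s m in auto)
    obtain t2 where t2: "t2 \<le> T2 a" "exec c2 ?s5 t2 ?s6"
      by (rule runsD[OF r(2), of ?s5 a]) (use s m in auto)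
    have 1: "exec (Assign m (Var 0)) s (2 + size (e a)) ?s1"
      by (rule exec_Assign) (use s in \<open>simp_all\<close>)
    have 3: "exec (Assign (Suc m) (Var 0)) ?s2 (2 + size (e1 (f a))) ?s3"
      by (rule exec_Assign) (use m in \<open>simp_all\<close>)
    have 4: "exec (Assign 0 (Var m)) ?s3 (2 + size (e a)) ?s4"
      by (rule exec_Assign) (use m in \<open>simp_all\<close>)
    have 5: "exec (Assign m LeafE) ?s4 2 ?s5"
      by (rule exec_Assign) (use m in \<open>simp_all\<close>)
    have 7: "exec (Assign 0 (NodeE (Var (Suc m)) (Var 0))) ?s6
       (2 + (1 + size (e1 (f a))) + (1 + size (e2 (g a)))) ?s7"
      by (rule exec_Assign) (use m in \<open>simp_all\<close>)
    have 8: "exec (Assign (Suc m) LeafE) ?s7 2 ?s8"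
      by (rule exec_Assign) (use m in \<open>simp_all\<close>)
    have eq: "?s8 = s(0 := enc_prod e1 e2 (f a, g a))"
      using s m by (auto simp: fun_eq_iff)
    note E = exec.Seq[OF 1 exec.Seq[OF t1(2) exec.Seq[OF 3 exec.Seq[OF 4 exec.Seq[OF 5
      exec.Seq[OF t2(2) exec.Seq[OF 7 8]]]]]]]
    show "\<exists>t \<le> ?T a. exec ?c s t (s(0 := enc_prod e1 e2 (f a, g a)))"
      by (rule exI, rule conjI[rotated], rule E[unfolded eq]) (use t1(1) t2(1) in simp)
  qed
  ultimately show ?thesis unfolding ptime_def by blast
qed

lemma ptime_cond:
  fixes e :: "'a \<Rightarrow> tree"
  assumes "ptime e e' f" "ptime e e' g"
  shows "ptime (enc_prod enc_bool e) e' (\<lambda>(b, x). if b then f x else g x)"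
proof -
  from assms obtain c1 k1 T1 c2 k2 T2 where
    T: "pbound e T1" "pbound e T2" and r: "runs c1 k1 e e' f T1" "runs c2 k2 e e' g T2"
    unfolding ptime_def by blast
  let ?A = "Assign 0 (RightE (Var 0))"
  let ?c = "If (LeftE (Var 0)) (Seq ?A c1) (Seq ?A c2)"
  let ?T = "\<lambda>(b, a). T1 a + T2 a + 2 * size (e a) + 20"
  obtain p q where p: "\<And>a. T1 a \<le> poly p (size (e a))" and q: "\<And>a. T2 a \<le> poly q (size (e a))"
    using T unfolding pbound_def by blast
  let ?e = "enc_prod enc_bool e"
  have "pbound ?e (\<lambda>x. poly p (size (?e x)) + poly q (size (?e x)) + 2 * size (?e x) + 20)"
    by (intro pbounds pbound_poly pbound_size)
  then have "pbound ?e ?T"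
  proof (rule pbound_mono)
    fix x :: "bool \<times> 'a"
    obtain b a where x: "x = (b, a)" by (cases x)
    have "size (e a) \<le> size (?e x)" by (simp add: x)
    then show "?T x \<le> poly p (size (?e x)) + poly q (size (?e x)) + 2 * size (?e x) + 20"
      using le_trans[OF p poly_nat_mono, of a "size (?e x)"]
        le_trans[OF q poly_nat_mono, of a "size (?e x)"]
      by (simp only: x prod.case) (simp add: x)
  qed
  moreover have "runs ?c (max k1 k2) ?e e' (\<lambda>(b, x). if b then f x else g x) ?T"
    unfolding runs_def
  proof (intro allI impI)
    fix x :: "bool \<times> 'a" and s :: state
    assume s: "s 0 = ?e x \<and> (\<forall>x. 0 < x \<and> x < max k1 k2 \<longrightarrow> s x = Leaf)"
    obtain b a where x: "x = (b, a)" by (cases x)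
    let ?s1 = "s(0 := e a)"
    have 1: "exec ?A s (3 + size (s 0)) ?s1"
      by (rule exec_Assign) (use s in \<open>simp_all add: x\<close>)
    show "\<exists>t \<le> ?T x. exec ?c s t (s(0 := e' ((\<lambda>(b, x). if b then f x else g x) x)))"
    proof (cases b)
      case True
      obtain t1 where t1: "t1 \<le> T1 a" "exec c1 ?s1 t1 (s(0 := e' (f a)))"
        by (rule runsD[OF r(1), of ?s1 a]) (use s in auto)
      have "val (LeftE (Var 0)) s \<noteq> Leaf" using s True by (simp add: x)
      from exec.IfTrue[OF this exec.Seq[OF 1 t1(2)]]
      have E: "exec ?c s (1 + cost (LeftE (Var 0)) s + (1 + (3 + size (s 0)) + t1)) (s(0 := e' (f a)))" .
      show ?thesis
        by (rule exI, rule conjI[rotated]) (use E s t1(1) True in \<open>auto simp: x\<close>)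
    next
      case False
      obtain t1 where t1: "t1 \<le> T2 a" "exec c2 ?s1 t1 (s(0 := e' (g a)))"
        by (rule runsD[OF r(2), of ?s1 a]) (use s in auto)
      have "val (LeftE (Var 0)) s = Leaf" using s False by (simp add: x)
      from exec.IfFalse[OF this exec.Seq[OF 1 t1(2)]]
      have E: "exec ?c s (1 + cost (LeftE (Var 0)) s + (1 + (3 + size (s 0)) + t1)) (s(0 := e' (g a)))" .
      show ?thesis
        by (rule exI, rule conjI[rotated]) (use E s t1(1) False in \<open>auto simp: x\<close>)
    qed
  qed
  ultimately show ?thesis unfolding ptime_def by blast
qed

lemma ptime_if:
  assumes "ptime e enc_bool b" "ptime e e' f" "ptime e e' g"
  shows "ptime e e' (\<lambda>x. if b x then f x else g x)"
  using ptime_comp[OF ptime_Pair[OF assms(1) ptime_id] ptime_cond[OF assms(2,3)]] by simp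

section \<open>Loops over lists\<close>

text \<open>
  The loop keeps the environment in variable \<open>k\<close>, the rest of the list in \<open>k + 1\<close> and the accumulator
  in \<open>0\<close>. Each pass is cheap as long as the accumulator is: \<open>M\<close> bounds all of its values.
\<close>

lemma exec_foldl:
  fixes e :: "'e \<Rightarrow> tree" and ex :: "'x \<Rightarrow> tree" and ea :: "'a \<Rightarrow> tree"
    and g :: "'e \<Rightarrow> 'x \<Rightarrow> 'a \<Rightarrow> 'a" and env :: 'e and c :: com and k :: nat
  defines "body \<equiv> Seq (Assign 0 (NodeE (Var k) (NodeE (LeftE (Var (Suc k))) (Var 0))))
      (Seq c (Assign (Suc k) (RightE (Var (Suc k)))))"
  assumes r: "runs c k (enc_prod e (enc_prod ex ea)) ea (\<lambda>q. g (fst q) (fst (snd q)) (snd (snd q))) T"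
    and T: "\<And>q. T q \<le> poly p (size (enc_prod e (enc_prod ex ea) q))"
    and k: "0 < k" and Z: "size (e env) \<le> Z"
  shows "s k = e env \<Longrightarrow> s (Suc k) = enc_list ex ys \<Longrightarrow> s 0 = ea acc \<Longrightarrow>
     (\<And>y. 0 < y \<Longrightarrow> y < k \<Longrightarrow> s y = Leaf) \<Longrightarrow> size (enc_list ex ys) \<le> Z \<Longrightarrow>
     (\<And>i. i \<le> length ys \<Longrightarrow> size (ea (foldl (\<lambda>acc h. g env h acc) acc (take i ys))) \<le> M) \<Longrightarrow>
     \<exists>t \<le> Suc (length ys) * (poly p (2 + 2 * Z + M) + 6 * Z + M + 30).
       exec (While (Var (Suc k)) body) s t
         (s(0 := ea (foldl (\<lambda>acc h. g env h acc) acc ys), Suc k := Leaf))"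
proof (induction ys arbitrary: s acc)
  case Nil
  have eq: "s(0 := ea (foldl (\<lambda>acc h. g env h acc) acc []), Suc k := Leaf) = s"
    using Nil by (auto simp: fun_eq_iff)
  show ?case
    unfolding eq using exec.WhileFalse[of "Var (Suc k)" s body] Nil
    by (intro exI[of _ "1 + cost (Var (Suc k)) s"]) simp
next
  case (Cons h ys)
  let ?K = "poly p (2 + 2 * Z + M) + 6 * Z + M + 30"
  let ?acc' = "g env h acc"
  let ?s1 = "s(0 := Node (e env) (Node (ex h) (ea acc)))"
  let ?s2 = "?s1(0 := ea ?acc')"
  let ?s3 = "?s2(Suc k := enc_list ex ys)"
  have M: "size (ea acc) \<le> M" using Cons.prems(6)[of 0] by simp
  have 1: "exec (Assign 0 (NodeE (Var k) (NodeE (LeftE (Var (Suc k))) (Var 0)))) s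
     (1 + (1 + (1 + size (e env)) + (1 + (2 + size (s (Suc k))) + (1 + size (ea acc))))) ?s1"
    by (rule exec_Assign) (use Cons.prems in simp_all)
  obtain t where t: "t \<le> T (env, h, acc)" "exec c ?s1 t ?s2"
    by (rule runsD[OF r, of ?s1 "(env, h, acc)"]) (use Cons.prems k in auto)
  have 2: "exec (Assign (Suc k) (RightE (Var (Suc k)))) ?s2 (3 + size (s (Suc k))) ?s3"
    by (rule exec_Assign) (use Cons.prems k in simp_all)
  have "T (env, h, acc) \<le> poly p (2 + 2 * Z + M)"
    by (rule le_trans[OF T poly_nat_mono]) (use Z M Cons.prems(5) in simp)
  with t have t': "t \<le> poly p (2 + 2 * Z + M)" by simp
  have IH: "\<exists>t \<le> Suc (length ys) * ?K.
      exec (While (Var (Suc k)) body) ?s3 t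
        (?s3(0 := ea (foldl (\<lambda>acc h. g env h acc) ?acc' ys), Suc k := Leaf))"
  proof (rule Cons.IH)
    show "size (ea (foldl (\<lambda>acc h. g env h acc) ?acc' (take i ys))) \<le> M" if "i \<le> length ys" for i
      using Cons.prems(6)[of "Suc i"] that by simp
  qed (use Cons.prems k in auto)
  then obtain t2 where t2: "t2 \<le> Suc (length ys) * ?K"
    "exec (While (Var (Suc k)) body) ?s3 t2
        (?s3(0 := ea (foldl (\<lambda>acc h. g env h acc) ?acc' ys), Suc k := Leaf))"
    by blast
  have eq: "?s3(0 := ea (foldl (\<lambda>acc h. g env h acc) ?acc' ys), Suc k := Leaf) =
      s(0 := ea (foldl (\<lambda>acc h. g env h acc) acc (h # ys)), Suc k := Leaf)"
    by (auto simp: fun_eq_iff)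
  have "val (Var (Suc k)) s \<noteq> Leaf" using Cons.prems by simp
  note E = exec.WhileTrue[OF this exec.Seq[OF 1 exec.Seq[OF t(2) 2], folded body_def] t2(2), unfolded eq]
  show ?case
    by (rule exI, rule conjI[rotated], rule E)
      (use t' t2(1) M Z Cons.prems(2,5) in simp)
qed

text \<open>
  The loop starts from environment, list and initial accumulator packed into one tree. The encoding \<open>d\<close>
  admits only the triples that arise from an environment, so that the size bound is needed for no
  others.
\<close>

lemma ptime_foldl_raw:
  assumes g: "ptime (enc_prod e (enc_prod ex ea)) ea (\<lambda>q. g (fst q) (fst (snd q)) (snd (snd q)))"
    and d: "\<And>env. d env = Node (e env) (Node (enc_list ex (xs env)) (ea (a env)))"
    and B: "pbound d B"
    and bound: "\<And>env i. i \<le> length (xs env) \<Longrightarrow>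
       size (ea (foldl (\<lambda>acc h. g env h acc) (a env) (take i (xs env)))) \<le> B env"
  shows "ptime d ea (\<lambda>env. foldl (\<lambda>acc h. g env h acc) (a env) (xs env))"
proof -
  from g obtain c k' T where T: "pbound (enc_prod e (enc_prod ex ea)) T"
    and r': "runs c k' (enc_prod e (enc_prod ex ea)) ea (\<lambda>q. g (fst q) (fst (snd q)) (snd (snd q))) T"
    unfolding ptime_def by blast
  from T obtain p where p: "\<And>q. T q \<le> poly p (size (enc_prod e (enc_prod ex ea) q))"
    unfolding pbound_def by blast
  define k where "k = Suc k'"
  have r: "runs c k (enc_prod e (enc_prod ex ea)) ea (\<lambda>q. g (fst q) (fst (snd q)) (snd (snd q))) T"
    using r' unfolding runs_def k_def by simp
  have k: "0 < k" by (simp add: k_def)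
  let ?body = "Seq (Assign 0 (NodeE (Var k) (NodeE (LeftE (Var (Suc k))) (Var 0))))
      (Seq c (Assign (Suc k) (RightE (Var (Suc k)))))"
  let ?c = "Seq (Assign k (LeftE (Var 0))) (Seq (Assign (Suc k) (LeftE (RightE (Var 0))))
    (Seq (Assign 0 (RightE (RightE (Var 0)))) (Seq (While (Var (Suc k)) ?body) (Assign k LeafE))))"
  let ?Z = "\<lambda>env. size (d env)"
  \<comment> \<open>an upper bound for the time of the loop, by \<open>exec_foldl\<close>\<close>
  let ?W = "\<lambda>env. Suc (?Z env) * (poly p (2 + 2 * ?Z env + B env) + 6 * ?Z env + B env + 30)"
  let ?T = "\<lambda>env. ?W env + 3 * ?Z env + 30"
  have "pbound d ?T" by (intro pbounds pbound_size B pbound_poly)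
  moreover have "runs ?c (k + 2) d ea (\<lambda>env. foldl (\<lambda>acc h. g env h acc) (a env) (xs env)) ?T"
    unfolding runs_def
  proof (intro allI impI)
    fix env and s :: state
    assume s: "s 0 = d env \<and> (\<forall>x. 0 < x \<and> x < k + 2 \<longrightarrow> s x = Leaf)"
    let ?r = "foldl (\<lambda>acc h. g env h acc) (a env) (xs env)"
    let ?s1 = "s(k := e env)"
    let ?s2 = "?s1(Suc k := enc_list ex (xs env))"
    let ?s3 = "?s2(0 := ea (a env))"
    let ?s4 = "?s3(0 := ea ?r, Suc k := Leaf)"
    have 1: "exec (Assign k (LeftE (Var 0))) s (3 + size (d env)) ?s1"
      by (rule exec_Assign) (use s d in simp_all)
    have 2: "exec (Assign (Suc k) (LeftE (RightE (Var 0)))) ?s1 (4 + size (d env)) ?s2"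
      by (rule exec_Assign) (use s k d in simp_all)
    have 3: "exec (Assign 0 (RightE (RightE (Var 0)))) ?s2 (4 + size (d env)) ?s3"
      by (rule exec_Assign) (use s k d in simp_all)
    have 5: "exec (Assign k LeafE) ?s4 2 (?s4(k := Leaf))"
      by (rule exec_Assign) simp_all
    have "\<exists>t \<le> Suc (length (xs env)) * (poly p (2 + 2 * ?Z env + B env) + 6 * ?Z env + B env + 30).
       exec (While (Var (Suc k)) ?body) ?s3 t ?s4"
      by (rule exec_foldl[OF r p k]) (use s k d bound in auto)
    then obtain t where t: "t \<le> Suc (length (xs env)) * (poly p (2 + 2 * ?Z env + B env) + 6 * ?Z env + B env + 30)"
      "exec (While (Var (Suc k)) ?body) ?s3 t ?s4" by blast
    have "length ys \<le> size (enc_list ex ys)" for ys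
      by (induction ys) auto
    then have "length (xs env) \<le> ?Z env" by (simp add: d le_SucI trans_le_add1 trans_le_add2)
    then have tW: "t \<le> ?W env"
      by (intro le_trans[OF t(1)] mult_right_mono) auto
    have eq: "?s4(k := Leaf) = s(0 := ea ?r)"
      using s k by (auto simp: fun_eq_iff)
    note E = exec.Seq[OF 1 exec.Seq[OF 2 exec.Seq[OF 3 exec.Seq[OF t(2) 5]]], unfolded eq]
    show "\<exists>t \<le> ?T env. exec ?c s t (s(0 := ea ?r))"
      by (rule exI, rule conjI[rotated], rule E) (use tW in linarith)
  qed
  ultimately show ?thesis unfolding ptime_def by blast
qed

text \<open>
  Iterating a polynomial-time function can produce exponentially large values, so a polynomial
  bound \<open>B\<close> on all intermediate accumulators is required. It needs to hold only
  along the actual computation.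
\<close>

lemma ptime_foldl:
  assumes "ptime e (enc_list ex) xs" "ptime e ea a"
    and g: "ptime (enc_prod e (enc_prod ex ea)) ea (\<lambda>q. g (fst q) (fst (snd q)) (snd (snd q)))"
    and B: "pbound e B"
    and bound: "\<And>env i. i \<le> length (xs env) \<Longrightarrow>
       size (ea (foldl (\<lambda>acc h. g env h acc) (a env) (take i (xs env)))) \<le> B env"
  shows "ptime e ea (\<lambda>env. foldl (\<lambda>acc h. g env h acc) (a env) (xs env))"
proof -
  define d where "d env = Node (e env) (Node (enc_list ex (xs env)) (ea (a env)))" for env
  have 1: "ptime e d (\<lambda>x. x)"
    by (rule ptime_cong[OF ptime_Pair[OF ptime_id[of e] ptime_Pair[OF assms(1,2)]]])
      (simp_all add: d_def)
  from B obtain p where p: "\<And>env. B env \<le> poly p (size (e env))" unfolding pbound_def by blast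
  have "pbound d B"
    unfolding pbound_def
    by (intro exI[of _ p] allI le_trans[OF p] poly_nat_mono) (simp add: d_def)
  from ptime_comp[OF 1 ptime_foldl_raw[OF g d_def this bound]]
  show ?thesis .
qed

section \<open>Projections, constants and booleans\<close>

lemma ptime_fst: "ptime e (enc_prod e1 e2) f \<Longrightarrow> ptime e e1 (\<lambda>x. fst (f x))"
proof (erule ptime_comp)
  show "ptime (enc_prod e1 e2) e1 fst"
    by (rule ptime_exp[of "LeftE (Var 0)"]) (auto split: prod.splits)
qed

lemma ptime_snd: "ptime e (enc_prod e1 e2) f \<Longrightarrow> ptime e e2 (\<lambda>x. snd (f x))"
proof (erule ptime_comp)
  show "ptime (enc_prod e1 e2) e2 snd"
    by (rule ptime_exp[of "RightE (Var 0)"]) (auto split: prod.splits)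
qed

fun exp_of :: "tree \<Rightarrow> exp" where
  "exp_of Leaf = LeafE"
| "exp_of (Node l r) = NodeE (exp_of l) (exp_of r)"

lemma ptime_const: "ptime e e' (\<lambda>_. c)"
proof (rule ptime_exp)
  show "only_input (exp_of t)" for t by (induction t) auto
  show "val (exp_of t) s = t" for s t by (induction t) auto
qed

lemma ptime_Cons:
  "ptime e ex f \<Longrightarrow> ptime e (enc_list ex) g \<Longrightarrow> ptime e (enc_list ex) (\<lambda>x. f x # g x)"
  by (rule ptime_cong[OF ptime_Pair[of e ex f "enc_list ex" g]]) auto

lemma ptime_tl:
  assumes "ptime e (enc_list ex) f"
  shows "ptime e (enc_list ex) (\<lambda>x. tl (f x))"
proof (rule ptime_comp[OF assms])
  have "enc_list ex (tl xs) = right (enc_list ex xs)" for xs by (cases xs) auto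
  then show "ptime (enc_list ex) (enc_list ex) tl"
    by (intro ptime_exp[of "RightE (Var 0)"]) auto
qed

lemma ptime_not: "ptime e enc_bool f \<Longrightarrow> ptime e enc_bool (\<lambda>x. \<not> f x)"
  by (rule ptime_cong[OF ptime_if[OF _ ptime_const[of e enc_bool False] ptime_const[of e enc_bool True]]]) auto

lemma ptime_conj:
  "ptime e enc_bool f \<Longrightarrow> ptime e enc_bool g \<Longrightarrow> ptime e enc_bool (\<lambda>x. f x \<and> g x)"
  by (rule ptime_cong[OF ptime_if[of e f enc_bool g "\<lambda>_. False"]]) (auto intro: ptime_const)

lemma ptime_disj:
  "ptime e enc_bool f \<Longrightarrow> ptime e enc_bool g \<Longrightarrow> ptime e enc_bool (\<lambda>x. f x \<or> g x)"
  by (rule ptime_cong[OF ptime_if[of e f enc_bool "\<lambda>_. True" g]]) (auto intro: ptime_const)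

section \<open>Unary numbers\<close>

text \<open>
  The computation itself is carried out in unary, where numbers double as loop counters; all numbers
  that occur are polynomially bounded.
\<close>

fun enc_una :: "nat \<Rightarrow> tree" where
  "enc_una 0 = Leaf"
| "enc_una (Suc n) = Node Leaf (enc_una n)"

lemma size_enc_una [simp]: "size (enc_una n) = n"
  by (induction n) auto

lemma pbound_una: "ptime e enc_una f \<Longrightarrow> pbound e f"
  using pbound_ptime[of e enc_una f] by simp

lemma enc_una_replicate: "enc_una n = enc_list (\<lambda>_::unit. Leaf) (replicate n ())"
  by (induction n) auto

text \<open>
  Counted iteration is a fold over a list of units, whose encoding is the unary number itself.
\<close>

lemma ptime_funpow:
  assumes n: "ptime e enc_una n" and a: "ptime e ea a"
    and g: "ptime (enc_prod e ea) ea (\<lambda>q. g (fst q) (snd q))"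
    and B: "pbound e B"
    and bound: "\<And>env i. i \<le> n env \<Longrightarrow> size (ea ((g env ^^ i) (a env))) \<le> B env"
  shows "ptime e ea (\<lambda>env. (g env ^^ n env) (a env))"
proof -
  let ?u = "\<lambda>_::unit. Leaf"
  have fold: "foldl (\<lambda>acc _. f acc) x (replicate k ()) = (f ^^ k) x" for f :: "'b \<Rightarrow> 'b" and x k
    by (induction k arbitrary: x) (auto simp: funpow_swap1)
  have take: "take i (replicate k ()) = replicate i ()" if "i \<le> k" for i k
    using that by (simp add: min_def)
  have "ptime e ea (\<lambda>env. foldl (\<lambda>acc h. g env acc) (a env) (replicate (n env) ()))"
  proof (rule ptime_foldl[OF _ a _ B])
    show "ptime e (enc_list ?u) (\<lambda>env. replicate (n env) ())"
      by (rule ptime_cong[OF n]) (simp_all add: enc_una_replicate)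
    show "ptime (enc_prod e (enc_prod ?u ea)) ea (\<lambda>q. g (fst q) (snd (snd q)))"
      using ptime_comp[OF ptime_Pair[OF ptime_fst[OF ptime_id] ptime_snd[OF ptime_snd[OF ptime_id]]] g,
          of ?u] by simp
  qed (simp add: take fold bound)
  then show ?thesis by (simp add: fold)
qed

lemma ptime_Suc: "ptime e enc_una f \<Longrightarrow> ptime e enc_una (\<lambda>x. Suc (f x))"
  by (erule ptime_comp) (rule ptime_exp[of "NodeE LeafE (Var 0)"], auto)

lemma ptime_pred:
  assumes "ptime e enc_una f"
  shows "ptime e enc_una (\<lambda>x. f x - 1)"
proof (rule ptime_comp[OF assms])
  have "enc_una (n - 1) = right (enc_una n)" for n by (cases n) auto
  then show "ptime enc_una enc_una (\<lambda>n. n - 1)"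
    by (intro ptime_exp[of "RightE (Var 0)"]) auto
qed

lemma ptime_add:
  assumes "ptime e enc_una f" "ptime e enc_una g"
  shows "ptime e enc_una (\<lambda>x. f x + g x)"
proof -
  have "ptime e enc_una (\<lambda>x. (Suc ^^ g x) (f x))"
    by (rule ptime_funpow[OF assms(2,1), where g = "\<lambda>_. Suc" and B = "\<lambda>x. f x + g x"])
      (simp_all add: ptime_Suc[OF ptime_snd[OF ptime_id]] pbound_add pbound_una assms)
  then show ?thesis by (simp add: add.commute)
qed

lemma ptime_diff:
  assumes "ptime e enc_una f" "ptime e enc_una g"
  shows "ptime e enc_una (\<lambda>x. f x - g x)"
proof -
  have eq: "((\<lambda>n. n - 1) ^^ k) m = m - k" for k m :: nat by (induction k) auto
  have "ptime e enc_una (\<lambda>x. ((\<lambda>n. n - 1) ^^ g x) (f x))"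
    by (rule ptime_funpow[OF assms(2,1) _ pbound_una[OF assms(1)]])
      (simp_all add: eq[simplified] ptime_pred[OF ptime_snd[OF ptime_id], simplified])
  then show ?thesis by (simp add: eq[simplified])
qed

lemma ptime_mult:
  assumes "ptime e enc_una f" "ptime e enc_una g"
  shows "ptime e enc_una (\<lambda>x. f x * g x)"
proof -
  have eq: "((\<lambda>n. n + m) ^^ k) 0 = m * k" for k m :: nat by (induction k) auto
  have "ptime e enc_una (\<lambda>x. ((\<lambda>n. n + f x) ^^ g x) 0)"
  proof (rule ptime_funpow[OF assms(2) ptime_const, where B = "\<lambda>x. f x * g x"])
    show "ptime (enc_prod e enc_una) enc_una (\<lambda>q. snd q + f (fst q))"
      by (intro ptime_add ptime_snd[OF ptime_id] ptime_comp[OF ptime_fst[OF ptime_id] assms(1)])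
  qed (simp_all add: eq pbound_mult pbound_una assms)
  then show ?thesis by (simp add: eq)
qed

text \<open>
  A loop that overwrites its accumulator with \<open>True\<close> turns a nonempty tree into the encoding of \<open>True\<close>.
\<close>

lemma ptime_pos:
  assumes "ptime e enc_una f"
  shows "ptime e enc_bool (\<lambda>x. 0 < f x)"
proof -
  have eq: "((\<lambda>_. True) ^^ k) False \<longleftrightarrow> 0 < k" for k :: nat by (induction k) auto
  have "size (enc_bool b) \<le> 1" for b by (cases b) auto
  then have "ptime e enc_bool (\<lambda>x. ((\<lambda>_. True) ^^ f x) False)"
    by (intro ptime_funpow[OF assms, where B = "\<lambda>_. 1"]) (auto intro: ptime_const pbounds)
  then show ?thesis by (simp add: eq)
qed

lemma ptime_less:
  "ptime e enc_una f \<Longrightarrow> ptime e enc_una g \<Longrightarrow> ptime e enc_bool (\<lambda>x. f x < g x)"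
  by (rule ptime_cong[OF ptime_pos[OF ptime_diff[of e g f]]]) auto

lemma ptime_le:
  "ptime e enc_una f \<Longrightarrow> ptime e enc_una g \<Longrightarrow> ptime e enc_bool (\<lambda>x. f x \<le> g x)"
  by (rule ptime_cong[OF ptime_not[OF ptime_less[of e g f]]]) (auto simp: not_less)

section \<open>Lists\<close>

lemma size_enc_list: "size (enc_list ex xs) = (\<Sum>x\<leftarrow>xs. Suc (size (ex x)))"
  by (induction xs) auto

lemma size_enc_list_le:
  assumes "length xs \<le> l" "\<And>x. x \<in> set xs \<Longrightarrow> size (ex x) \<le> b"
  shows "size (enc_list ex xs) \<le> l * Suc b"
proof -
  have "size (enc_list ex xs) \<le> (\<Sum>x\<leftarrow>xs. Suc b)"
    unfolding size_enc_list by (rule sum_list_mono) (use assms in auto)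
  also have "\<dots> = length xs * Suc b" by (simp add: sum_list_triv)
  also have "\<dots> \<le> l * Suc b" using assms by (intro mult_right_mono) auto
  finally show ?thesis .
qed

lemma size_elem_enc_list: "x \<in> set xs \<Longrightarrow> size (ex x) \<le> size (enc_list ex xs)"
  by (induction xs) auto

lemma length_le_size_enc_list: "length xs \<le> size (enc_list ex xs)"
  by (induction xs) auto

lemma pbound_length: "ptime e (enc_list ex) f \<Longrightarrow> pbound e (\<lambda>x. length (f x))"
  by (rule pbound_mono[OF pbound_ptime[of e "enc_list ex" f]]) (simp_all add: length_le_size_enc_list)

lemma ptime_rev:
  assumes "ptime e (enc_list ex) f"
  shows "ptime e (enc_list ex) (\<lambda>x. rev (f x))"
proof -
  have eq: "foldl (\<lambda>acc h. h # acc) ys xs = rev xs @ ys" for xs ys :: "'b list"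
    by (induction xs arbitrary: ys) auto
  have *: "size (enc_list ex (rev (take i xs))) \<le> size (enc_list ex xs)" for i xs
  proof -
    have "size (enc_list ex (take i xs)) + size (enc_list ex (drop i xs)) = size (enc_list ex xs)"
      unfolding size_enc_list sum_list_append[symmetric] map_append[symmetric] by simp
    then show ?thesis by (simp add: size_enc_list rev_map[symmetric])
  qed
  have "ptime e (enc_list ex) (\<lambda>x. foldl (\<lambda>acc h. h # acc) [] (f x))"
  proof (rule ptime_foldl[OF assms ptime_const _ pbound_ptime[OF assms]])
    show "ptime (enc_prod e (enc_prod ex (enc_list ex))) (enc_list ex) (\<lambda>q. fst (snd q) # snd (snd q))"
      by (rule ptime_Cons[OF ptime_fst[OF ptime_snd[OF ptime_id]] ptime_snd[OF ptime_snd[OF ptime_id]]])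
  qed (simp add: eq *)
  then show ?thesis by (simp add: eq)
qed

lemma ptime_map:
  assumes f: "ptime (enc_prod e ex) ey (\<lambda>q. f (fst q) (snd q))" and xs: "ptime e (enc_list ex) xs"
  shows "ptime e (enc_list ey) (\<lambda>x. map (f x) (xs x))"
proof -
  obtain p where p: "\<And>q. size (ey (f (fst q) (snd q))) \<le> poly p (size (enc_prod e ex q))"
    using pbound_ptime[OF f] unfolding pbound_def by blast
  have eq: "foldl (\<lambda>acc h. g h # acc) zs ys = rev (map g ys) @ zs" for g :: "'b \<Rightarrow> 'c" and ys zs
    by (induction ys arbitrary: zs) auto
  let ?B = "\<lambda>x. length (xs x) * Suc (poly p (Suc (size (e x) + size (enc_list ex (xs x)))))"
  have "ptime e (enc_list ey) (\<lambda>x. foldl (\<lambda>acc h. f x h # acc) [] (xs x))"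
  proof (rule ptime_foldl[OF xs ptime_const, where B = ?B])
    show "ptime (enc_prod e (enc_prod ex (enc_list ey))) (enc_list ey)
        (\<lambda>q. f (fst q) (fst (snd q)) # snd (snd q))"
      using ptime_comp[OF ptime_Pair[OF ptime_fst[OF ptime_id] ptime_fst[OF ptime_snd[OF ptime_id]]] f]
      by (intro ptime_Cons ptime_snd[OF ptime_snd[OF ptime_id]]) simp
    show "pbound e ?B"
      by (intro pbounds pbound_length[OF xs] pbound_poly pbound_size pbound_ptime[OF xs])
    show "size (enc_list ey (foldl (\<lambda>acc h. f x h # acc) [] (take i (xs x)))) \<le> ?B x" for x i
    proof (rule size_enc_list_le)
      fix y assume "y \<in> set (foldl (\<lambda>acc h. f x h # acc) [] (take i (xs x)))"
      then obtain h where h: "h \<in> set (xs x)" "y = f x h"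
        by (auto simp: eq dest: in_set_takeD)
      have "size (ey y) \<le> poly p (size (enc_prod e ex (x, h)))"
        using p[of "(x, h)"] h by simp
      also have "\<dots> \<le> poly p (Suc (size (e x) + size (enc_list ex (xs x))))"
        using size_elem_enc_list[OF h(1), of ex] by (intro poly_nat_mono) simp
      finally show "size (ey y) \<le> poly p (Suc (size (e x) + size (enc_list ex (xs x))))" .
    qed (simp add: eq)
  qed
  from ptime_rev[OF this] show ?thesis by (simp add: eq)
qed

lemma ptime_list_ex:
  assumes P: "ptime (enc_prod e ex) enc_bool (\<lambda>q. P (fst q) (snd q))" and xs: "ptime e (enc_list ex) xs"
  shows "ptime e enc_bool (\<lambda>x. list_ex (P x) (xs x))"
proof -
  have eq: "foldl (\<lambda>acc h. acc \<or> Q h) b ys \<longleftrightarrow> b \<or> list_ex Q ys" for Q :: "'b \<Rightarrow> bool" and b ys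
    by (induction ys arbitrary: b) auto
  have size: "size (enc_bool b) \<le> 1" for b by (cases b) auto
  note size = size[unfolded One_nat_def]
  have "ptime e enc_bool (\<lambda>x. foldl (\<lambda>acc h. acc \<or> P x h) False (xs x))"
  proof (rule ptime_foldl[OF xs ptime_const, where B = "\<lambda>_. 1"])
    show "ptime (enc_prod e (enc_prod ex enc_bool)) enc_bool
        (\<lambda>q. snd (snd q) \<or> P (fst q) (fst (snd q)))"
      using ptime_comp[OF ptime_Pair[OF ptime_fst[OF ptime_id] ptime_fst[OF ptime_snd[OF ptime_id]]] P]
      by (intro ptime_disj ptime_snd[OF ptime_snd[OF ptime_id]]) simp
  qed (simp_all add: pbound_const size)
  then show ?thesis by (simp add: eq)
qed

lemma ptime_length:
  assumes xs: "ptime e (enc_list ex) xs"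
  shows "ptime e enc_una (\<lambda>x. length (xs x))"
proof -
  have eq: "foldl (\<lambda>acc _. Suc acc) k ys = k + length ys" for k and ys :: "'b list"
    by (induction ys arbitrary: k) auto
  have "ptime e enc_una (\<lambda>x. foldl (\<lambda>acc _. Suc acc) 0 (xs x))"
    by (rule ptime_foldl[OF xs ptime_const, where B = "\<lambda>x. length (xs x)"])
      (simp_all add: eq ptime_Suc[OF ptime_snd[OF ptime_snd[OF ptime_id]]] pbound_length[OF xs])
  then show ?thesis by (simp add: eq)
qed

lemma ptime_upt:
  assumes n: "ptime e enc_una n"
  shows "ptime e (enc_list enc_una) (\<lambda>x. [0..<n x])"
proof -
  have eq: "((\<lambda>acc. 0 # map Suc acc) ^^ k) [] = [0..<k]" for k
    by (induction k) (auto simp: map_Suc_upt upt_conv_Cons simp del: upt_Suc)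
  have "ptime e (enc_list enc_una) (\<lambda>x. ((\<lambda>acc. 0 # map Suc acc) ^^ n x) [])"
  proof (rule ptime_funpow[OF n ptime_const, where B = "\<lambda>x. n x * Suc (n x)"])
    show "ptime (enc_prod e (enc_list enc_una)) (enc_list enc_una) (\<lambda>q. 0 # map Suc (snd q))"
      by (rule ptime_Cons[OF ptime_const ptime_map[OF ptime_Suc[OF ptime_snd[OF ptime_id]]
            ptime_snd[OF ptime_id]]])
    show "size (enc_list enc_una (((\<lambda>acc. 0 # map Suc acc) ^^ i) [])) \<le> n x * Suc (n x)"
      if "i \<le> n x" for x i
      unfolding eq by (rule size_enc_list_le) (use that in auto)
  qed (intro pbounds pbound_una n)
  then show ?thesis by (simp add: eq)
qed

text \<open>
  Taking the tail of the empty tree leaves it empty, and so does taking its head; with a default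
  value encoded by \<open>Leaf\<close>, no range check is needed.
\<close>

lemma ptime_nthd:
  assumes d: "ex d = Leaf" and xs: "ptime e (enc_list ex) xs" and n: "ptime e enc_una n"
  shows "ptime e ex (\<lambda>x. nthd d (xs x) (n x))"
proof -
  have size: "size (enc_list ex (drop i ys)) \<le> size (enc_list ex ys)" for i ys
  proof -
    have "size (enc_list ex (take i ys)) + size (enc_list ex (drop i ys)) = size (enc_list ex ys)"
      unfolding size_enc_list sum_list_append[symmetric] map_append[symmetric] by simp
    then show ?thesis by simp
  qed
  have eq: "(tl ^^ k) ys = drop k ys" for k and ys :: "'z list"
    by (induction k) (auto simp: drop_Suc tl_drop)
  have "ptime e (enc_list ex) (\<lambda>x. (tl ^^ n x) (xs x))"
    by (rule ptime_funpow[OF n xs _ pbound_ptime[OF xs]])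
      (simp_all add: eq size ptime_tl[OF ptime_snd[OF ptime_id]])
  then have "ptime e (enc_list ex) (\<lambda>x. drop (n x) (xs x))" by (simp add: eq)
  moreover have "left (enc_list ex ys) = ex (nthd d ys 0)" for ys
    by (cases ys) (auto simp: nthd_def d)
  then have "ptime (enc_list ex) ex (\<lambda>ys. nthd d ys 0)"
    by (intro ptime_exp[of "LeftE (Var 0)"]) auto
  ultimately have "ptime e ex (\<lambda>x. nthd d (drop (n x) (xs x)) 0)"
    by (rule ptime_comp)
  moreover have "nthd d (drop i ys) 0 = nthd d ys i" for i ys
    by (cases "i < length ys") (auto simp: nthd_def)
  ultimately show ?thesis by simp
qed

section \<open>Binary numbers\<close>

text \<open>
  Unary numbers are converted for output by counting in binary.
\<close>

fun binc :: "bool list \<Rightarrow> bool list" where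
  "binc [] = [True]"
| "binc (False # bs) = True # bs"
| "binc (True # bs) = False # binc bs"

lemma bits_Suc: "bits (Suc n) = binc (bits n)"
proof (induction n rule: less_induct)
  case (less n)
  show ?case
  proof (cases "n = 0")
    case True
    then show ?thesis by (simp add: bits.simps)
  next
    case False
    show ?thesis
    proof (cases "odd n")
      case True
      then have "bits (Suc n) = False # bits (Suc (n div 2))"
        by (subst bits.simps) simp
      also have "\<dots> = False # binc (bits (n div 2))" using less[of "n div 2"] False by simp
      also have "\<dots> = binc (bits n)" using True by (subst (2) bits.simps) (auto simp: odd_pos)
      finally show ?thesis .
    next
      case even: False
      then have "bits (Suc n) = True # bits (n div 2)" by (subst bits.simps) simp
      also have "\<dots> = binc (bits n)" using even False by (subst (2) bits.simps) auto
      finally show ?thesis .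
    qed
  qed
qed

lemma length_binc: "length (binc bs) \<le> Suc (length bs)"
  by (induction bs rule: binc.induct) auto

lemma length_bits: "length (bits n) \<le> n"
proof (induction n)
  case (Suc n)
  then show ?case unfolding bits_Suc using length_binc[of "bits n"] by linarith
qed (simp add: bits.simps)

lemma size_enc_bools: "size (enc_list enc_bool bs) \<le> 2 * length bs"
proof (induction bs)
  case (Cons b bs)
  then show ?case by (cases b) auto
qed simp

text \<open>
  One digit of the addition of one, as a step of a fold: the accumulator holds the carry and the digits
  produced so far, in reverse.
\<close>

definition carry_step :: "bool \<Rightarrow> bool \<times> bool list \<Rightarrow> bool \<times> bool list" where
  "carry_step b acc = (fst acc \<and> b, (if fst acc then \<not> b else b) # snd acc)"

lemma binc_eq_foldl:
  "binc bs = (let q = foldl (\<lambda>acc b. carry_step b acc) (True, []) bs in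
     rev (if fst q then True # snd q else snd q))"
proof -
  have [simp]: "carry_step b (True, r) = (b, (\<not> b) # r)" "carry_step b (False, r) = (False, b # r)" for b r
    by (auto simp: carry_step_def)
  have F: "foldl (\<lambda>acc b. carry_step b acc) (False, r) bs = (False, rev bs @ r)" for r bs
    by (induction bs arbitrary: r) auto
  have "(let q = foldl (\<lambda>acc b. carry_step b acc) (True, r) bs in
     rev (if fst q then True # snd q else snd q)) = rev r @ binc bs" for r
    by (induction bs arbitrary: r rule: binc.induct) (auto simp: F Let_def)
  from this[of "[]"] show ?thesis by simp
qed

lemma ptime_binc:
  "ptime (enc_list enc_bool) (enc_list enc_bool) binc"
proof -
  let ?q = "foldl (\<lambda>acc b. carry_step b acc) (True, [])"
  have len: "length (snd (foldl (\<lambda>acc b. carry_step b acc) q bs)) = length (snd q) + length bs" for q bs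
    by (induction bs arbitrary: q) (auto simp: carry_step_def)
  have size: "size (enc_prod enc_bool (enc_list enc_bool) q) \<le> 2 + 2 * length (snd q)" for q
    using size_enc_bools[of "snd q"] by (cases q; cases "fst q") auto
  have q: "ptime (enc_list enc_bool) (enc_prod enc_bool (enc_list enc_bool)) ?q"
  proof (rule ptime_foldl[OF ptime_id ptime_const, where B = "\<lambda>bs. 2 + 2 * length bs"])
    show "ptime (enc_prod (enc_list enc_bool) (enc_prod enc_bool (enc_prod enc_bool (enc_list enc_bool))))
       (enc_prod enc_bool (enc_list enc_bool)) (\<lambda>q. carry_step (fst (snd q)) (snd (snd q)))"
      (is "ptime ?e _ _")
    proof -
      have b: "ptime ?e enc_bool (\<lambda>q. fst (snd q))"
        by (rule ptime_fst[OF ptime_snd[OF ptime_id]])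
      have c: "ptime ?e enc_bool (\<lambda>q. fst (snd (snd q)))"
        by (rule ptime_fst[OF ptime_snd[OF ptime_snd[OF ptime_id]]])
      have r: "ptime ?e (enc_list enc_bool) (\<lambda>q. snd (snd (snd q)))"
        by (rule ptime_snd[OF ptime_snd[OF ptime_snd[OF ptime_id]]])
      show ?thesis
        unfolding carry_step_def by (rule ptime_Pair[OF ptime_conj[OF c b] ptime_Cons[OF ptime_if[OF c ptime_not[OF b] b] r]])
    qed
    show "pbound (enc_list enc_bool) (\<lambda>bs. 2 + 2 * length bs)"
      by (intro pbounds pbound_length[OF ptime_id])
    fix bs :: "bool list" and i
    show "size (enc_prod enc_bool (enc_list enc_bool) (?q (take i bs))) \<le> 2 + 2 * length bs"
      using size[of "?q (take i bs)"] len[of "(True, [])" "take i bs"] by simp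
  qed
  have "ptime (enc_list enc_bool) (enc_list enc_bool)
      (\<lambda>bs. rev (if fst (?q bs) then True # snd (?q bs) else snd (?q bs)))"
    by (intro ptime_rev ptime_if ptime_Cons ptime_const ptime_fst[OF q] ptime_snd[OF q])
  then show ?thesis by (rule ptime_cong) (simp_all add: binc_eq_foldl Let_def)
qed

lemma ptime_binary:
  assumes f: "ptime e enc_una f"
  shows "ptime e enc_nat f"
proof -
  have eq: "(binc ^^ n) [] = bits n" for n
    by (induction n) (simp_all add: bits_Suc, simp add: bits.simps)
  have "ptime e (enc_list enc_bool) (\<lambda>x. (binc ^^ f x) [])"
  proof (rule ptime_funpow[OF f ptime_const, where B = "\<lambda>x. 2 * f x"])
    show "ptime (enc_prod e (enc_list enc_bool)) (enc_list enc_bool) (\<lambda>q. binc (snd q))"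
      by (rule ptime_comp[OF ptime_snd[OF ptime_id] ptime_binc])
    show "pbound e (\<lambda>x. 2 * f x)" by (intro pbounds pbound_una f)
    show "size (enc_list enc_bool ((binc ^^ i) [])) \<le> 2 * f x" if "i \<le> f x" for i x
      using size_enc_bools[of "bits i"] length_bits[of i] that by (simp add: eq)
  qed
  then show ?thesis by (rule ptime_cong) (simp_all add: eq enc_nat_def)
qed

lemma ptime_int:
  assumes "ptime e enc_una f"
  shows "ptime e enc_int (\<lambda>x. int (f x))"
  by (rule ptime_cong[OF ptime_Pair[OF ptime_const[of e enc_bool False] ptime_binary[OF assms]]])
    (simp_all add: enc_int_def)

section \<open>Running time of the algorithm\<close>

abbreviation enc_matrix :: "bool list list \<Rightarrow> tree" where
  "enc_matrix \<equiv> enc_list (enc_list enc_bool)"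

lemma ptime_nthd_una:
  "ptime e (enc_list enc_una) xs \<Longrightarrow> ptime e enc_una n \<Longrightarrow> ptime e enc_una (\<lambda>z. nthd 0 (xs z) (n z))"
  by (rule ptime_nthd) auto

lemma ptime_entry:
  "ptime e enc_matrix M \<Longrightarrow> ptime e enc_una x \<Longrightarrow> ptime e enc_una y \<Longrightarrow>
   ptime e enc_bool (\<lambda>z. entry (M z) (x z) (y z))"
  unfolding entry_def by (intro ptime_nthd) auto

text \<open>
  Under a binder the environment is paired with the bound value: \<open>ptime_env\<close> reaches a function of the outer
  environment, \<open>ptime_bound\<close> the bound value.
\<close>

lemmas ptime_env = ptime_comp[OF ptime_fst[OF ptime_id]]
lemmas ptime_bound = ptime_snd[OF ptime_id]

lemma ptime_conflict:
  assumes M: "ptime e enc_matrix M" and W: "ptime e (enc_list enc_una) W"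
    and L: "ptime e (enc_list enc_una) L" and y: "ptime e enc_una y"
  shows "ptime e enc_bool (\<lambda>z. conflict (M z) (W z) (L z) (y z))"
  unfolding conflict_def
proof (rule ptime_list_ex)
  note facts = ptime_env[OF M] ptime_env[OF W] ptime_env[OF L] ptime_env[OF y] ptime_bound
  show "ptime (enc_prod e enc_una) enc_bool (\<lambda>q.
     (entry (M (fst q)) (snd q) (y (fst q)) \<and>
        nthd 0 (L (fst q)) (y (fst q)) \<le> nthd 0 (L (fst q)) (snd q) + nthd 0 (W (fst q)) (snd q)) \<or>
     (\<not> entry (M (fst q)) (y (fst q)) (snd q) \<and>
        nthd 0 (L (fst q)) (y (fst q)) + nthd 0 (W (fst q)) (y (fst q)) < nthd 0 (L (fst q)) (snd q)))"
    by (intro ptime_disj ptime_conj ptime_not ptime_less ptime_le ptime_add ptime_entry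
      ptime_nthd_una facts)
  show "ptime e (enc_list enc_una) (\<lambda>z. [0..<length (M z)])"
    by (rule ptime_upt[OF ptime_length[OF M]])
qed

lemma ptime_lift:
  assumes M: "ptime e enc_matrix M" and W: "ptime e (enc_list enc_una) W"
    and L: "ptime e (enc_list enc_una) L"
  shows "ptime e (enc_list enc_una) (\<lambda>z. lift (M z) (W z) (L z))"
  unfolding lift_def
proof (rule ptime_map)
  note facts = ptime_env[OF M] ptime_env[OF W] ptime_env[OF L] ptime_bound
  show "ptime (enc_prod e enc_una) enc_una (\<lambda>q. if conflict (M (fst q)) (W (fst q)) (L (fst q)) (snd q)
      then Suc (nthd 0 (L (fst q)) (snd q)) else nthd 0 (L (fst q)) (snd q))"
    by (intro ptime_if ptime_conflict ptime_Suc ptime_nthd_una facts)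
  show "ptime e (enc_list enc_una) (\<lambda>z. [0..<length (M z)])"
    by (rule ptime_upt[OF ptime_length[OF M]])
qed

text \<open>
  The values grow by at most one per round, for every matrix and weight list; this bounds the size of
  the accumulator in the main loop.
\<close>

lemma nthd_lift_funpow_le: "nthd 0 ((lift M W ^^ i) (map (\<lambda>_. 0) [0..<length M])) y \<le> i"
proof (induction i arbitrary: y)
  case (Suc i)
  then show ?case by (auto simp: lift_def le_SucI)
qed simp

lemma ptime_lifted:
  assumes M: "ptime e enc_matrix M" and W: "ptime e (enc_list enc_una) W"
  shows "ptime e (enc_list enc_una) (\<lambda>z. lifted (M z) (W z))"
  unfolding lifted_def
proof (rule ptime_funpow)
  note n = ptime_length[OF M]
  show R: "ptime e enc_una (\<lambda>z. rounds (length (M z)))"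
    unfolding rounds_def by (intro ptime_mult ptime_Suc ptime_add n)
  show "ptime e (enc_list enc_una) (\<lambda>z. map (\<lambda>_. 0) [0..<length (M z)])"
    by (rule ptime_map[OF ptime_const ptime_upt[OF n]])
  show "ptime (enc_prod e (enc_list enc_una)) (enc_list enc_una)
      (\<lambda>q. lift (M (fst q)) (W (fst q)) (snd q))"
    by (intro ptime_lift ptime_env[OF M] ptime_env[OF W] ptime_bound)
  show "pbound e (\<lambda>z. length (M z) * Suc (rounds (length (M z))))"
    by (intro pbounds pbound_length[OF M] pbound_una R)
  fix z i assume i: "i \<le> rounds (length (M z))"
  let ?L = "(lift (M z) (W z) ^^ i) (map (\<lambda>_. 0) [0..<length (M z)])"
  show "size (enc_list enc_una ?L) \<le> length (M z) * Suc (rounds (length (M z)))"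
  proof (rule size_enc_list_le)
    fix x assume "x \<in> set ?L"
    then obtain y where "y < length ?L" "x = ?L ! y" by (auto simp only: in_set_conv_nth)
    then have "x = nthd 0 ?L y" by (simp add: nthd_def)
    then show "size (enc_una x) \<le> rounds (length (M z))"
      using nthd_lift_funpow_le[where M = "M z" and W = "W z" and i = i and y = y] i by simp
  qed simp
qed

lemma ptime_Some:
  "ptime e ex f \<Longrightarrow> ptime e (enc_option ex) (\<lambda>z. Some (f z))"
  by (erule ptime_comp) (rule ptime_exp[of "NodeE LeafE (Var 0)"], auto)

lemma ptime_read_off:
  assumes M: "ptime e enc_matrix M" and W: "ptime e (enc_list enc_una) W"
    and L: "ptime e (enc_list enc_una) L"
  shows "ptime e enc_answer (\<lambda>z. read_off (M z) (W z) (L z))"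
  unfolding read_off_def enc_answer_def
proof (intro ptime_if ptime_Some)
  note n = ptime_length[OF M]
  note facts = ptime_env[OF M] ptime_env[OF W] ptime_env[OF L] ptime_bound
  show "ptime e enc_bool (\<lambda>z. list_ex (conflict (M z) (W z) (L z)) [0..<length (M z)])"
    by (rule ptime_list_ex[OF ptime_conflict ptime_upt[OF n]]) (rule facts)+
  show "ptime e (enc_option (enc_list (enc_prod enc_fraction enc_fraction))) (\<lambda>z. None)"
    by (rule ptime_const)
  show "ptime e (enc_list (enc_prod enc_fraction enc_fraction))
     (\<lambda>z. map (\<lambda>y. ((int (nthd 0 (L z) y), length (M z)),
        (int (nthd 0 (L z) y + nthd 0 (W z) y), length (M z)))) [0..<length (M z)])"
    unfolding enc_fraction_def
    by (rule ptime_map[OF _ ptime_upt[OF n]], intro ptime_Pair ptime_int ptime_binary ptime_add ptime_nthd_una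
      ptime_length[OF ptime_env[OF M]] facts)
qed

lemma ptime_schedule:
  assumes M: "ptime e enc_matrix M" and W: "ptime e (enc_list enc_una) W"
  shows "ptime e enc_answer (\<lambda>z. schedule (M z) (W z))"
  unfolding schedule_def by (rule ptime_read_off[OF M W ptime_lifted[OF M W]])

lemma ptime_scaled_01:
  assumes M: "ptime e enc_matrix M"
  shows "ptime e (enc_list enc_una) (\<lambda>z. scaled_01 (M z))"
  unfolding scaled_01_def
proof (rule ptime_map[OF _ ptime_upt[OF ptime_length[OF M]]])
  note M1 = ptime_env[OF M] and v1 = ptime_bound
  note M2 = ptime_env[OF M1] and v2 = ptime_env[OF v1] and x2 = ptime_bound
  note M3 = ptime_env[OF M2] and v3 = ptime_env[OF v2] and x3 = ptime_env[OF x2] and y3 = ptime_bound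
  have P: "ptime (enc_prod (enc_prod (enc_prod e enc_una) enc_una) enc_una) enc_bool (\<lambda>q.
       let M = M (fst (fst (fst q))); v = snd (fst (fst q)); x = snd (fst q); y = snd q in
       \<not> entry M v x \<and> \<not> entry M x v \<and> \<not> entry M v y \<and> \<not> entry M y v \<and> entry M x y)"
    unfolding Let_def by (intro ptime_conj ptime_not ptime_entry M3 v3 x3 y3)
  show "ptime (enc_prod e enc_una) enc_una (\<lambda>q.
     if list_ex (\<lambda>x. list_ex (\<lambda>y. \<not> entry (M (fst q)) (snd q) x \<and> \<not> entry (M (fst q)) x (snd q) \<and>
          \<not> entry (M (fst q)) (snd q) y \<and> \<not> entry (M (fst q)) y (snd q) \<and> entry (M (fst q)) x y)
        [0..<length (M (fst q))]) [0..<length (M (fst q))]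
     then length (M (fst q)) else 0)"
    by (intro ptime_if ptime_list_ex[where ex = enc_una] P[unfolded Let_def] ptime_upt ptime_length[OF M1]
        ptime_length[OF M2] ptime_const)
qed

lemma ptime_odd: "ptime enc_nat enc_bool odd"
proof (rule ptime_exp)
  have "left (enc_nat n) = enc_bool (odd n)" for n
    by (subst enc_nat_def, subst bits.simps) simp
  then show "val (LeftE (Var 0)) s = enc_bool (odd n)" if "s 0 = enc_nat n" for s n
    using that by simp
qed simp

lemma ptime_scaled_12:
  assumes M: "ptime e enc_matrix M" and fs: "ptime e (enc_list enc_nat) fs"
  shows "ptime e (enc_list enc_una) (\<lambda>z. scaled_12 (M z) (fs z))"
  unfolding scaled_12_def
proof (rule ptime_map[OF _ fs])
  note n = ptime_length[OF ptime_env[OF M]]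
  show "ptime (enc_prod e enc_nat) enc_una
      (\<lambda>q. if odd (snd q) then length (M (fst q)) else length (M (fst q)) + length (M (fst q)))"
    by (rule ptime_if[OF ptime_comp[OF ptime_bound ptime_odd] n ptime_add[OF n n]])
qed

text \<open>
  The instance type may carry more than the algorithm sees: \<open>h\<close> extracts the data that is encoded.
\<close>

lemma poly_time_solvableI:
  assumes "ptime e eout F" "\<And>i. i \<in> D \<Longrightarrow> ein i = e (h i)" "\<And>i. i \<in> D \<Longrightarrow> S i (F (h i))"
  shows "poly_time_solvable ein eout D S"
proof -
  from assms(1) obtain c k T where T: "pbound e T" and r: "runs c k e eout F T"
    unfolding ptime_def by blast
  from T obtain p where p: "\<And>a. T a \<le> poly p (size (e a))" unfolding pbound_def by blast
  show ?thesis
    unfolding poly_time_solvable_def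
  proof (rule exI[of _ c], rule exI[of _ p], rule ballI)
    fix i assume i: "i \<in> D"
    obtain t where t: "t \<le> T (h i)"
      "exec c ((\<lambda>_. Leaf)(0 := e (h i))) t (((\<lambda>_. Leaf)(0 := e (h i)))(0 := eout (F (h i))))"
      by (rule runsD[OF r, of "(\<lambda>_. Leaf)(0 := e (h i))" "h i"]) auto
    show "\<exists>out t. computes_in_time c (ein i) (eout out) t \<and> t \<le> poly p (size (ein i)) \<and> S i out"
      unfolding computes_in_time_def
      using t(2) le_trans[OF t(1) p] assms(2,3)[OF i]
      by (intro exI[of _ "F (h i)"] exI[of _ t]) (auto simp del: fun_upd_upd)
  qed
qed

theorem mainTheorem3:
  shows "poly_time_solvable enc_poset enc_answer
           {(xs :: nat list, R). distinct xs \<and> finite_poset (set xs) R}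
           (\<lambda>(xs, R). correct_answer xs (interval_rep_01 (set xs) R)) \<and>
         poly_time_solvable enc_weighted_poset enc_answer
           {(xs :: nat list, R, f).
              distinct xs \<and> finite_poset (set xs) R \<and> (\<forall>x\<in>set xs. f x \<in> {1, 2})}
           (\<lambda>(xs, R, f). correct_answer xs (interval_rep_weighted (set xs) R f))"
proof
  show "poly_time_solvable enc_poset enc_answer
           {(xs :: nat list, R). distinct xs \<and> finite_poset (set xs) R}
           (\<lambda>(xs, R). correct_answer xs (interval_rep_01 (set xs) R))"
  proof (rule poly_time_solvableI[where h = "\<lambda>(xs, R). adjacency_matrix xs R"])
    show "ptime enc_matrix enc_answer (\<lambda>M. schedule M (scaled_01 M))"
      by (rule ptime_schedule[OF ptime_id ptime_scaled_01[OF ptime_id]])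
  qed (auto simp: enc_poset_def schedule_01_correct)
  show "poly_time_solvable enc_weighted_poset enc_answer
           {(xs :: nat list, R, f).
              distinct xs \<and> finite_poset (set xs) R \<and> (\<forall>x\<in>set xs. f x \<in> {1, 2})}
           (\<lambda>(xs, R, f). correct_answer xs (interval_rep_weighted (set xs) R f))"
  proof (rule poly_time_solvableI[where h = "\<lambda>(xs, R, f). (adjacency_matrix xs R, map f xs)"])
    show "ptime (enc_prod enc_matrix (enc_list enc_nat)) enc_answer
        (\<lambda>q. schedule (fst q) (scaled_12 (fst q) (snd q)))"
      by (rule ptime_schedule[OF ptime_fst[OF ptime_id]
            ptime_scaled_12[OF ptime_fst[OF ptime_id] ptime_snd[OF ptime_id]]])
  qed (auto simp: enc_poset_def enc_weighted_poset_def schedule_12_correct)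
qed

end
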